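(* Consider the Bayesian mixture model with a prior on the number of components described in the context, with $\boldsymbol{\theta} := (W,V)$ the random parameter. Assume: (1) for every measurable $A\subseteq\mathcal{X}$, the function $v\mapsto F_v(A)$ is measurable on $\mathcal{V}$; (2) (finite mixture identifiability) for all $k,k'\in\{1,2,\ldots\}$, $w\in\Delta_k$, $w'\in\Delta_{k'}$, $v\in\mathcal{V}^k$, $v'\in\mathcal{V}^{k'}$, if $P_{w,v}=P_{w',v'}$ then $\sum_{i=1}^k w_i\delta_{v_i}=\sum_{i=1}^{k'} w'_i\delta_{v'_i}$, where $\delta_x$ is the unit point mass at $x$; (3) for all $k\in\{1,2,\ldots\}$ and all $1\le i<j\le k$, $\mathbb{P}(V_i=V_j\mid K=k)=0$. Then there exists $\Theta_*\subseteq\Theta$ such that $\mathbb{P}(\boldsymbol{\theta}\in\Theta_* )=1$ and, for all $\theta_0\in\Theta_*$, if $X_1,X_2,\ldots\sim P_{\theta_0}$ i.i.d., then for all $\varepsilon>0$, $$\lim_{n\to\infty}\mathbb{P}\big(\boldsymbol{\theta}\in\tilde{B}(\theta_0,\varepsilon)\mid X_1,\ldots,X_n\big)=1\quad\text{a.s.}[P_{\theta_0}]$$ and $$\lim_{n\to\infty}\mathbb{P}\big(K=k(\theta_0)\mid X_1,\ldots,X_n\big)=1\quad\text{a.s.}[P_{\theta_0}].$$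
   Context: Setting. $(F_v:v\in\mathcal{V})$ is a family of probability measures on $\mathcal{X}$, where $\mathcal{V}\subseteq\mathbb{R}^D$ is (Borel) measurable and $\mathcal{X}$ is a Borel measurable subset of a complete separable metric space, equipped with its Borel sigma-algebra. Each $\mathbb{R}^d$ has the Euclidean topology and its Borel sigma-algebra. For $k\in\{1,2,\ldots\}$ let $\Delta_k:=\{w\in(0,1]^k:\sum_{i=1}^k w_i=1\}\subseteq\mathbb{R}^k$ (so $\Delta_1=\{1\}$ and, for $k\ge 2$, all coordinates lie in $(0,1)$). For $w\in\Delta_k$ and $v\in\mathcal{V}^k$, let $P_{w,v}:=\sum_{i=1}^k w_iF_{v_i}$, a probability measure on $\mathcal{X}$. Model. Let $\pi$, $D_k$, $G_k$ be probability measures on $\{1,2,\ldots\}$, $\Delta_k$, $\mathcal{V}^k$, respectively (for each $k\ge1$). The model is: $K\sim\pi$; given $K=k$, $W=(W_1,\ldots,W_k)\sim D_k$ and $V=(V_1,\ldots,V_k)\sim G_k$, with $W$ and $V$ conditionally independent given $K$; and given $(W,V)$, the observations $X_1,X_2,\ldots$ are i.i.d. from $P_{W,V}$. $\mathbb{P}$ denotes probability under this model; $\mathbb{P}(W\in\cdot\mid K=k)$ and $\mathbb{P}(V\in\cdot\mid K=k)$ mean $D_k$ and $G_k$. Parameter space. $\Theta_k:=\Delta_k\times\mathcal{V}^k$ and $\Theta:=\bigcup_{k=1}^\infty\Theta_k$ (a disjoint union). For $\theta=(w,v)\in\Theta$, $k(\theta)$ is the unique $k$ with $\theta\in\Theta_k$,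 and $P_\theta:=P_{w,v}$. Define the metric on $\Theta$ $$d_\Theta(\theta,\theta')=\begin{cases}\min\{\|\theta-\theta'\|,1\}&\text{if }k(\theta)=k(\theta'),\\ 1&\text{otherwise,}\end{cases}$$ where $\|\cdot\|$ is the Euclidean norm on $\Delta_k\times\mathcal{V}^k\subseteq\mathbb{R}^{k+kD}$; $\Theta$ carries the resulting Borel sigma-algebra. Permutations. $S_k$ is the set of permutations of $\{1,\ldots,k\}$. For $\sigma\in S_k$ and $\theta=(w,v)\in\Theta_k$, $\theta[\sigma]:=(w_\sigma,v_\sigma)$ with $w_\sigma=(w_{\sigma_1},\ldots,w_{\sigma_k})$, $v_\sigma=(v_{\sigma_1},\ldots,v_{\sigma_k})$. For $\theta_0\in\Theta_k$ and $\varepsilon>0$, $$\tilde{B}(\theta_0,\varepsilon):=\bigcup_{\sigma\in S_k}\{\theta\in\Theta:d_\Theta(\theta,\theta_0[\sigma])<\varepsilon\}.$$ Posterior. The conditional probabilities $\mathbb{P}(\,\cdot\mid X_1,\ldots,X_n)$ are those of the assumed model, i.e. given by a (fixed for each $n$) regular conditional distribution of $\boldsymbol{\theta}$ given $X_1,\ldots,X_n$ (with $K=k(\boldsymbol{\theta})$), evaluated at the data $X_1,\ldots,X_n$, which in the conclusion are drawn i.i.d. from $P_{\theta_0}$; "a.s.$[P_{\theta_0}]$" means almost surely when $X_1,X_2,\ldots$ are i.i.d. from $P_{\theta_0}$. *)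

theory Defs
  imports "HOL-Probability.Probability"
begin

text \<open>A \<open>k\<close>-tuple is an extensional function on \<open>{..<k}\<close>, so coordinates are numbered from 0;
  the Borel sigma-algebra of a finite power is \<open>PiM {..<k} (\<lambda>_. borel)\<close>.\<close>

definition Delta :: "nat \<Rightarrow> (nat \<Rightarrow> real) set" where
  "Delta k = {w \<in> PiE {..<k} (\<lambda>_. {0<..1}). (\<Sum>i<k. w i) = 1}"

definition Delta_borel :: "nat \<Rightarrow> (nat \<Rightarrow> real) measure" where
  "Delta_borel k = restrict_space (PiM {..<k} (\<lambda>_. borel)) (Delta k)"

definition power_borel :: "nat \<Rightarrow> 'v::topological_space set \<Rightarrow> (nat \<Rightarrow> 'v) measure" where
  "power_borel k V = PiM {..<k} (\<lambda>_. restrict_space borel V)"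

definition mixture :: "'a measure \<Rightarrow> nat \<Rightarrow> (nat \<Rightarrow> real) \<Rightarrow> (nat \<Rightarrow> 'a measure) \<Rightarrow> 'a measure" where
  "mixture N k w M =
     measure_of (space N) (sets N) (\<lambda>A. \<Sum>i<k. ennreal (w i) * emeasure (M i) A)"

text \<open>A parameter is a triple \<open>(k, w, v)\<close>; the tag \<open>k\<close> makes the union over \<open>k\<close> disjoint.\<close>

type_synonym 'v param = "nat \<times> (nat \<Rightarrow> real) \<times> (nat \<Rightarrow> 'v)"

definition Theta :: "'v set \<Rightarrow> 'v param set" where
  "Theta V = (\<Union>k\<in>{1..}. {k} \<times> Delta k \<times> PiE {..<k} (\<lambda>_. V))"

definition ncomp :: "'v param \<Rightarrow> nat" where
  "ncomp \<theta> = fst \<theta>"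

fun d_Theta :: "'v::real_normed_vector param \<Rightarrow> 'v param \<Rightarrow> real" where
  "d_Theta (k, w, v) (k', w', v') =
     (if k = k'
      then min (sqrt ((\<Sum>i<k. (w i - w' i)\<^sup>2) + (\<Sum>i<k. (norm (v i - v' i))\<^sup>2))) 1
      else 1)"

definition Theta_borel :: "'v::real_normed_vector set \<Rightarrow> 'v param measure" where
  "Theta_borel V =
     sigma (Theta V) {U. openin (Metric_space.mtopology (Theta V) d_Theta) U}"

fun permute_param :: "'v param \<Rightarrow> (nat \<Rightarrow> nat) \<Rightarrow> 'v param" where
  "permute_param (k, w, v) \<sigma> = (k, w \<circ> \<sigma>, v \<circ> \<sigma>)"

definition Btilde :: "'v::real_normed_vector set \<Rightarrow> 'v param \<Rightarrow> real \<Rightarrow> 'v param set" where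
  "Btilde V \<theta>\<^sub>0 \<epsilon> =
     (\<Union>\<sigma>\<in>{\<sigma>. \<sigma> permutes {..<ncomp \<theta>\<^sub>0}}.
        {\<theta> \<in> Theta V. d_Theta \<theta> (permute_param \<theta>\<^sub>0 \<sigma>) < \<epsilon>})"

fun P_param :: "'x::topological_space set \<Rightarrow> ('v \<Rightarrow> 'x measure) \<Rightarrow> 'v param \<Rightarrow> 'x measure" where
  "P_param X F (k, w, v) = mixture (restrict_space borel X) k w (\<lambda>i. F (v i))"

definition prior ::
  "'v::real_normed_vector set \<Rightarrow> nat measure \<Rightarrow> (nat \<Rightarrow> (nat \<Rightarrow> real) measure) \<Rightarrow>
   (nat \<Rightarrow> (nat \<Rightarrow> 'v) measure) \<Rightarrow> 'v param measure" where
  "prior V \<pi> D G =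
     do { k \<leftarrow> \<pi>;
          w \<leftarrow> D k;
          v \<leftarrow> G k;
          return (Theta_borel V) (k, w, v) }"

text \<open>The joint law of the parameter and the whole observation sequence, whose terms are
  numbered from 0.\<close>

definition model ::
  "'x::topological_space set \<Rightarrow> 'v::real_normed_vector set \<Rightarrow> ('v \<Rightarrow> 'x measure) \<Rightarrow>
   nat measure \<Rightarrow> (nat \<Rightarrow> (nat \<Rightarrow> real) measure) \<Rightarrow> (nat \<Rightarrow> (nat \<Rightarrow> 'v) measure) \<Rightarrow>
   ('v param \<times> (nat \<Rightarrow> 'x)) measure" where
  "model X V F \<pi> D G =
     do { \<theta> \<leftarrow> prior V \<pi> D G;
          x \<leftarrow> PiM UNIV (\<lambda>_. P_param X F \<theta>);
          return (Theta_borel V \<Otimes>\<^sub>M PiM UNIV (\<lambda>_. restrict_space borel X)) (\<theta>, x) }"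

text \<open>\<open>Q\<close> is a regular conditional distribution of \<open>Y\<close> (with values in \<open>N\<close>) given \<open>Z\<close>
  (with values in \<open>L\<close>) under \<open>M\<close>.\<close>

definition regular_cond_distr ::
  "'m measure \<Rightarrow> ('m \<Rightarrow> 'a) \<Rightarrow> 'a measure \<Rightarrow> ('m \<Rightarrow> 'b) \<Rightarrow> 'b measure \<Rightarrow>
   ('b \<Rightarrow> 'a measure) \<Rightarrow> bool" where
  "regular_cond_distr M Y N Z L Q \<longleftrightarrow>
     Q \<in> measurable L (prob_algebra N) \<and>
     (\<forall>A\<in>sets N. \<forall>B\<in>sets L.
        emeasure M {\<omega> \<in> space M. Y \<omega> \<in> A \<and> Z \<omega> \<in> B} =
        (\<integral>\<^sup>+z\<in>B. emeasure (Q z) A \<partial>distr M L Z))"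

end

theory Submission
  imports Defs
begin

text \<open>
  This is an instance of Doob's theorem: where the parameter is almost surely a function of the
  infinite data sequence, the posterior probability of an event about the parameter tends to its
  indicator, for almost every true parameter. A mixture determines its components only up to their
  order, so the argument is run for permutation-invariant sets of parameters.

  Call an event of the joint model observable if it can be approximated in measure by events that
  depend on finitely many observations. The proof has two halves.

  If \<open>{\<theta> \<in> U}\<close> is observable, then the posterior probability of \<open>U\<close> tends to 1 almost surely where
  \<open>\<theta> \<in> U\<close> (\<open>posterior_tendsto_1\<close>). The underlying lemma \<open>cond_prob_tendsto_0_off\<close> replaces the event by
  an approximation known from time \<open>m\<close> on, and then applies a maximal inequality to the conditional
  probabilities after time \<open>m\<close>.

  If \<open>U\<close> is a permutation-invariant Borel set, then \<open>{\<theta> \<in> U}\<close> is observable (\<open>observable_symmetric\<close>).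
  By the weak law of large numbers \<open>P\<^sub>\<theta>(A)\<close> is a limit in probability of empirical frequencies, so
  every Borel condition on the sequence \<open>\<tau> \<theta> = (P\<^sub>\<theta>(A\<^sub>j))\<^sub>j\<close> is observable, where the \<open>A\<^sub>j\<close> form a
  countable determining class. By identifiability \<open>\<tau>\<close> separates the orbits of parameters with distinct
  components, and these have prior probability 1; on them \<open>U\<close> is the preimage of \<open>\<tau> ` U\<close>. It remains
  to find Borel subsets of \<open>\<tau> ` U\<close> whose preimages nearly exhaust \<open>U\<close>. By inner regularity the graph
  of \<open>\<tau>\<close> over \<open>U\<close> contains compact sets of nearly full measure, and their projections are compact
  subsets of \<open>\<tau> ` U\<close> (\<open>inner_compact_image\<close>).

  The sets of parameters whose orbit meets a member of a countable basis form a countable family of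
  such \<open>U\<close>, and every \<open>Btilde V \<theta>\<^sub>0 \<epsilon>\<close> contains one of them around \<open>\<theta>\<^sub>0\<close>. Discarding countably many
  null sets and disintegrating the joint law over the prior gives the theorem.
\<close>

section \<open>Events approximable in measure\<close>

text \<open>
  The members need not lie in the sigma-algebra that \<open>\<A>\<close> generates: membership is insensitive to null
  sets, so that "the data determine the event almost surely" takes the form of a sigma-algebra.
\<close>

definition approximable :: "'a measure \<Rightarrow> 'a set set \<Rightarrow> 'a set set" where
  "approximable M \<A> = {A \<in> sets M. \<forall>\<delta>>0. \<exists>B\<in>\<A>. measure M (sym_diff A B) < \<delta>}"

lemma approximableI:
  assumes "A \<in> sets M" "\<And>\<delta>. \<delta> > 0 \<Longrightarrow> \<exists>B\<in>\<A>. measure M (sym_diff A B) < \<delta>"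
  shows "A \<in> approximable M \<A>"
  using assms by (auto simp: approximable_def)

lemma approximableE:
  assumes "A \<in> approximable M \<A>" "\<delta> > 0"
  obtains B where "B \<in> \<A>" "measure M (sym_diff A B) < \<delta>"
  using assms by (auto simp: approximable_def)

lemma (in finite_measure) measure_le_of_subset_Un:
  assumes "C \<subseteq> A \<union> B" "A \<in> sets M" "B \<in> sets M"
  shows "measure M C \<le> measure M A + measure M B"
proof -
  have "measure M C \<le> measure M (A \<union> B)"
    using assms by (intro finite_measure_mono) auto
  also have "\<dots> \<le> measure M A + measure M B"
    using assms by (intro measure_Un_le) auto
  finally show ?thesis .
qed

text \<open>
  A countable union is cut to a finite one at the cost of half of \<open>\<delta>\<close>, and the other half is shared
  among the finitely many remaining sets.
\<close>

lemma (in finite_measure) sigma_algebra_approximable: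
  assumes alg: "algebra (space M) \<A>" and sub: "\<A> \<subseteq> sets M"
  shows "sigma_algebra (space M) (approximable M \<A>)"
proof -
  interpret \<A>: algebra "space M" \<A> by fact
  show ?thesis unfolding sigma_algebra_iff2
  proof (intro conjI ballI allI impI)
    show "approximable M \<A> \<subseteq> Pow (space M)"
      using sets.sets_into_space by (auto simp: approximable_def)
    show "{} \<in> approximable M \<A>"
      by (intro approximableI) (auto intro!: bexI[of _ "{}"])
  next
    fix A assume A: "A \<in> approximable M \<A>"
    show "space M - A \<in> approximable M \<A>"
    proof (intro approximableI)
      show "space M - A \<in> sets M" using A by (auto simp: approximable_def)
      fix \<delta> :: real assume "\<delta> > 0"
      with A obtain B where B: "B \<in> \<A>" "measure M (sym_diff A B) < \<delta>"
        by (rule approximableE)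
      have "sym_diff (space M - A) (space M - B) = sym_diff A B"
        using sets.sets_into_space[of A M] sets.sets_into_space[of B M] A B sub
        by (auto simp: approximable_def)
      then show "\<exists>B\<in>\<A>. measure M (sym_diff (space M - A) B) < \<delta>"
        using B by (intro bexI[of _ "space M - B"]) auto
    qed
  next
    fix A :: "nat \<Rightarrow> 'a set" assume A: "range A \<subseteq> approximable M \<A>"
    then have As[measurable]: "A i \<in> sets M" for i by (auto simp: approximable_def)
    show "(\<Union>i. A i) \<in> approximable M \<A>"
    proof (intro approximableI)
      show "(\<Union>i. A i) \<in> sets M" by measurable
      fix \<delta> :: real assume \<delta>: "\<delta> > 0"
      have "(\<lambda>n. measure M (\<Union>i<n. A i)) \<longlonglongrightarrow> measure M (\<Union>n. \<Union>i<n. A i)"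
        by (intro finite_Lim_measure_incseq) (auto simp: incseq_def intro: less_le_trans)
      also have "(\<Union>n. \<Union>i<n. A i) = (\<Union>i. A i)" by auto
      finally have "\<forall>\<^sub>F n in sequentially. measure M (\<Union>i. A i) - \<delta>/2 < measure M (\<Union>i<n. A i)"
        using \<delta> by (intro order_tendstoD(1)) auto
      then obtain N where N: "measure M (\<Union>i. A i) - \<delta>/2 < measure M (\<Union>i<N. A i)"
        by (auto simp: eventually_sequentially)
      have tail: "measure M ((\<Union>i. A i) - (\<Union>i<N. A i)) < \<delta>/2"
        using N by (subst finite_measure_Diff) auto
      have "\<exists>B. B \<in> \<A> \<and> measure M (sym_diff (A i) B) < \<delta> / (2 * (N + 1))" for i
      proof -
        have "A i \<in> approximable M \<A>" "\<delta> / (2 * (N + 1)) > 0" using A \<delta> by auto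
        then show ?thesis by (meson approximableE)
      qed
      then obtain B where B: "\<And>i. B i \<in> \<A>" "\<And>i. measure M (sym_diff (A i) (B i)) < \<delta> / (2 * (N + 1))"
        by metis
      have Bs[measurable]: "B i \<in> sets M" for i using B sub by auto
      have "measure M (\<Union>i<N. sym_diff (A i) (B i)) \<le> (\<Sum>i<N. measure M (sym_diff (A i) (B i)))"
        by (intro finite_measure_subadditive_finite) auto
      also have "\<dots> \<le> (\<Sum>i<N. \<delta> / (2 * (N + 1)))"
        using B by (intro sum_mono less_imp_le)
      also have "\<dots> \<le> \<delta>/2" using \<delta> by (simp add: field_simps)
      finally have head: "measure M (\<Union>i<N. sym_diff (A i) (B i)) \<le> \<delta>/2" .
      have "measure M (sym_diff (\<Union>i. A i) (\<Union>i<N. B i))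
          \<le> measure M ((\<Union>i. A i) - (\<Union>i<N. A i)) + measure M (\<Union>i<N. sym_diff (A i) (B i))"
        by (intro measure_le_of_subset_Un) auto
      then have "measure M (sym_diff (\<Union>i. A i) (\<Union>i<N. B i)) < \<delta>"
        using head tail by linarith
      moreover have "(\<Union>i<N. B i) \<in> \<A>" using B by auto
      ultimately show "\<exists>B\<in>\<A>. measure M (sym_diff (\<Union>i. A i) B) < \<delta>" by blast
    qed
  qed
qed

text \<open>
  The threshold has to be moved: \<open>{c < f}\<close> and \<open>{c + \<eta> < fn n}\<close> differ only where \<open>fn n\<close> is
  \<open>\<eta>\<close>-far from \<open>f\<close> or where \<open>c < f \<le> c + 2 \<eta>\<close>, and the second set shrinks to the empty set with \<open>\<eta>\<close>.
\<close>

lemma (in finite_measure) approximable_limit_in_measure: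
  fixes f :: "'a \<Rightarrow> real"
  assumes f[measurable]: "f \<in> borel_measurable M"
    and fn: "\<And>n c. {\<omega> \<in> space M. c < fn n \<omega>} \<in> \<A>" and sub: "\<A> \<subseteq> sets M"
    and lim: "\<And>\<eta> \<delta>. \<eta> > 0 \<Longrightarrow> \<delta> > 0 \<Longrightarrow>
      \<exists>n. measure M {\<omega> \<in> space M. \<eta> \<le> \<bar>fn n \<omega> - f \<omega>\<bar>} < \<delta>"
  shows "{\<omega> \<in> space M. c < f \<omega>} \<in> approximable M \<A>"
proof (intro approximableI)
  have [measurable]: "fn n \<in> borel_measurable M" for n
    unfolding borel_measurable_iff_greater using fn sub by auto
  show "{\<omega> \<in> space M. c < f \<omega>} \<in> sets M" by measurable
  fix \<delta> :: real assume \<delta>: "\<delta> > 0"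
  let ?E = "\<lambda>n. {\<omega> \<in> space M. c < f \<omega> \<and> f \<omega> \<le> c + 2 / real (Suc n)}"
  have "(\<lambda>n. measure M (?E n)) \<longlonglongrightarrow> measure M (\<Inter>n. ?E n)"
  proof (intro finite_Lim_measure_decseq)
    show "decseq ?E" unfolding decseq_def
    proof safe
      fix m n \<omega> assume "m \<le> n" "f \<omega> \<le> c + 2 / real (Suc n)"
      moreover have "2 / real (Suc n) \<le> 2 / real (Suc m)"
        using \<open>m \<le> n\<close> by (intro divide_left_mono) auto
      ultimately show "f \<omega> \<le> c + 2 / real (Suc m)" by linarith
    qed
  qed auto
  also have "(\<Inter>n. ?E n) = {}"
  proof safe
    fix \<omega> assume *: "\<omega> \<in> (\<Inter>n. ?E n)"
    then have "(f \<omega> - c) / 2 > 0" by auto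
    from reals_Archimedean[OF this] obtain n where "inverse (real (Suc n)) < (f \<omega> - c) / 2" by auto
    then have "2 / real (Suc n) < f \<omega> - c" by (simp add: field_simps)
    moreover have "f \<omega> \<le> c + 2 / real (Suc n)" using * by auto
    ultimately show "\<omega> \<in> {}" by simp
  qed
  finally have "\<forall>\<^sub>F n in sequentially. measure M (?E n) < \<delta>/2"
    using \<delta> by (intro order_tendstoD(2)) auto
  then obtain N where N: "measure M (?E N) < \<delta>/2" by (auto simp: eventually_sequentially)
  define \<eta> where "\<eta> = 1 / real (Suc N)"
  have \<eta>: "\<eta> > 0" "2 / real (Suc N) = 2 * \<eta>" by (auto simp: \<eta>_def)
  obtain n where n: "measure M {\<omega> \<in> space M. \<eta> \<le> \<bar>fn n \<omega> - f \<omega>\<bar>} < \<delta>/2"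
    using lim[of \<eta> "\<delta>/2"] \<eta> \<delta> by auto
  have "measure M (sym_diff {\<omega> \<in> space M. c < f \<omega>} {\<omega> \<in> space M. c + \<eta> < fn n \<omega>})
      \<le> measure M (?E N) + measure M {\<omega> \<in> space M. \<eta> \<le> \<bar>fn n \<omega> - f \<omega>\<bar>}"
    unfolding \<eta>(2) by (intro measure_le_of_subset_Un) (auto split: abs_split)
  with N n have "measure M (sym_diff {\<omega> \<in> space M. c < f \<omega>} {\<omega> \<in> space M. c + \<eta> < fn n \<omega>}) < \<delta>"
    by linarith
  then show "\<exists>B\<in>\<A>. measure M (sym_diff {\<omega> \<in> space M. c < f \<omega>} B) < \<delta>"
    using fn by blast
qed

lemma algebra_UN_subalgebras:
  fixes F :: "nat \<Rightarrow> 'a measure"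
  assumes F: "\<And>n. space (F n) = \<Omega>" "\<And>m n. m \<le> n \<Longrightarrow> sets (F m) \<subseteq> sets (F n)"
  shows "algebra \<Omega> (\<Union>n. sets (F n))"
  unfolding algebra_iff_Un
proof (intro conjI ballI)
  show "(\<Union>n. sets (F n)) \<subseteq> Pow \<Omega>" using F(1) sets.sets_into_space by fastforce
  show "{} \<in> (\<Union>n. sets (F n))" by auto
  show "\<Omega> - A \<in> (\<Union>n. sets (F n))" if A: "A \<in> (\<Union>n. sets (F n))" for A
  proof -
    from A obtain n where "A \<in> sets (F n)" by blast
    from sets.compl_sets[OF this] show ?thesis using F(1) by auto
  qed
  show "A \<union> A' \<in> (\<Union>n. sets (F n))"
    if "A \<in> (\<Union>n. sets (F n))" "A' \<in> (\<Union>n. sets (F n))" for A A'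
  proof -
    obtain m n where "A \<in> sets (F m)" "A' \<in> sets (F n)" using \<open>A \<in> _\<close> \<open>A' \<in> _\<close> by blast
    then have "A \<in> sets (F (max m n))" "A' \<in> sets (F (max m n))"
      using F(2)[of m "max m n"] F(2)[of n "max m n"] by auto
    then show ?thesis by blast
  qed
qed

section \<open>Two limit theorems for the data\<close>

text \<open>
  The bound does not depend on \<open>N\<close>, so it can be integrated over the parameter.
\<close>

lemma weak_law_frequencies:
  fixes N :: "'a measure"
  assumes "prob_space N" and A[measurable]: "A \<in> sets N" and "n \<ge> 1" "\<eta> \<ge> 0"
  defines "S \<equiv> PiM (UNIV :: nat set) (\<lambda>_. N)"
  shows "measure S {x \<in> space S. \<eta> \<le> \<bar>(\<Sum>i<n. indicator A (x i)) / real n - measure N A\<bar>}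
    \<le> 2 * exp (- 2 * real n * \<eta>\<^sup>2)"
proof -
  interpret N: prob_space N by fact
  interpret S: product_prob_space "\<lambda>_. N" "UNIV :: nat set" ..
  have distr: "distr S N (\<lambda>x. x i) = N" for i
    unfolding S_def using S.PiM_component[of i] by simp
  have [measurable]: "(\<lambda>x. x i) \<in> S \<rightarrow>\<^sub>M N" for i unfolding S_def by measurable
  interpret SS: prob_space S unfolding S_def by (rule S.prob_space_axioms)
  have id: "distr S (PiM {..<n} (\<lambda>_. N)) (\<lambda>x. \<lambda>i\<in>{..<n}. x i) = PiM {..<n} (\<lambda>_. N)"
    unfolding S_def using S.distr_PiM_restrict_finite[of "{..<n}"] by (simp add: restrict_def)
  have "SS.indep_vars (\<lambda>_. N) (\<lambda>i x. x i) {..<n}"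
    using \<open>n \<ge> 1\<close> by (subst SS.indep_vars_iff_distr_eq_PiM') (auto simp: id distr lessThan_empty_iff)
  then have indep: "SS.indep_vars (\<lambda>_. borel) (\<lambda>i x. indicator A (x i) :: real) {..<n}"
    by (rule SS.indep_vars_compose2) auto
  have d: "distr S borel (\<lambda>x. indicator A (x i) :: real) = distr N borel (indicator A)" for i
  proof -
    have "distr (distr S N (\<lambda>x. x i)) borel (indicator A :: _ \<Rightarrow> real)
        = distr S borel (\<lambda>x. indicator A (x i) :: real)"
      by (subst distr_distr) (auto simp: comp_def)
    then show ?thesis by (simp add: distr)
  qed
  have ex: "SS.expectation (\<lambda>x. indicator A (x 0) :: real) = measure N A"
  proof -
    have "SS.expectation (\<lambda>x. indicator A (x 0) :: real) = integral\<^sup>L (distr S N (\<lambda>x. x 0)) (indicator A)"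
      by (subst integral_distr) auto
    then show ?thesis by (simp add: distr)
  qed
  interpret H: Hoeffding_ineq_iid S "{..<n}" "\<lambda>i x. indicator A (x i)" "\<lambda>x. indicator A (x 0)" 0 1
      "measure N A"
    by unfold_locales (auto simp: indep d ex)
  show ?thesis using H.Hoeffding_ineq_abs_ge'[of \<eta>] \<open>n \<ge> 1\<close> \<open>\<eta> \<ge> 0\<close> by (auto simp: lessThan_empty_iff)
qed

text \<open>
  A one-sided form of Levy's zero-one law; \<open>q n\<close> is a version of the conditional probability of \<open>W\<close>
  given \<open>F n\<close>. Choose \<open>m\<close> and \<open>B\<close> in \<open>F m\<close> with \<open>W\<close> and \<open>B\<close> differing by less than \<open>\<delta>\<close>. Off \<open>B\<close>, split
  according to the first time from \<open>m\<close> on at which \<open>q\<close> exceeds \<open>l\<close>. Each piece is known when its time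
  comes, so \<open>l\<close> times its probability is at most the probability that it shares with \<open>W\<close>; summed up,
  this is at most \<open>\<delta>\<close>. Hence \<open>q\<close> exceeds \<open>l\<close> infinitely often outside \<open>W\<close> with
  probability at most \<open>\<delta> + \<delta> / l\<close>, where \<open>\<delta>\<close> is arbitrary.
\<close>

lemma (in prob_space) cond_prob_tendsto_0_off:
  fixes q :: "nat \<Rightarrow> 'a \<Rightarrow> real"
  assumes F: "\<And>n. subalgebra M (F n)" "\<And>m n. m \<le> n \<Longrightarrow> sets (F m) \<subseteq> sets (F n)"
    and q: "\<And>n. q n \<in> borel_measurable (F n)" "\<And>n \<omega>. \<omega> \<in> space M \<Longrightarrow> 0 \<le> q n \<omega>"
    and cond: "\<And>n B. B \<in> sets (F n) \<Longrightarrow> (\<integral>\<^sup>+\<omega>\<in>B. ennreal (q n \<omega>) \<partial>M) = emeasure M (W \<inter> B)"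
    and W: "W \<in> approximable M (\<Union>n. sets (F n))"
  shows "AE \<omega> in M. \<omega> \<notin> W \<longrightarrow> (\<lambda>n. q n \<omega>) \<longlonglongrightarrow> 0"
proof -
  have Ws[measurable]: "W \<in> sets M" using W by (auto simp: approximable_def)
  have sp: "space (F n) = space M" for n using F(1) by (auto simp: subalgebra_def)
  have FM: "A \<in> sets (F n) \<Longrightarrow> A \<in> sets M" for A n using F(1) by (auto simp: subalgebra_def)
  have qM[measurable]: "q n \<in> borel_measurable M" for n
    using measurable_from_subalg[OF F(1) q(1)] .
  have level: "{\<omega> \<in> space M. l < q j \<omega>} \<in> sets (F n)" if "j \<le> n" for j n and l :: real
    using borel_measurable_iff_greater[THEN iffD1, OF q(1)[of j]] F(2)[OF that] by (auto simp: sp)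
  have main: "measure M ({\<omega> \<in> space M. \<exists>\<^sub>F n in sequentially. l < q n \<omega>} - W) \<le> \<delta> + \<delta> / l"
    if l: "l > 0" and \<delta>: "\<delta> > 0" for l \<delta> :: real
  proof -
    obtain m B where B: "B \<in> sets (F m)" "measure M (sym_diff W B) < \<delta>"
      using W \<delta> by (auto elim!: approximableE)
    have [measurable]: "B \<in> sets M" using B FM by auto
    \<comment> \<open>the part of the event, off \<open>B\<close>, where \<open>n\<close> is the first time from \<open>m\<close> on with \<open>q\<close> above \<open>l\<close>\<close>
    define A where "A n = (if n < m then {} else
      ({\<omega> \<in> space M. l < q n \<omega>} - B) - (\<Union>j\<in>{m..<n}. {\<omega> \<in> space M. l < q j \<omega>}))" for n
    have A: "A n \<in> sets (F n)" for n
      using level[of _ n l] B(1) F(2)[of m n] unfolding A_def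
      by (auto intro!: sets.Diff sets.finite_UN)
    have AM[measurable]: "A n \<in> sets M" for n using A FM by auto
    have disj: "disjoint_family A"
    proof (unfold disjoint_family_on_def, intro ballI impI)
      fix i j :: nat assume "i \<noteq> j"
      then consider "i < j" | "j < i" by linarith
      then show "A i \<inter> A j = {}" by cases (auto simp: A_def split: if_splits)
    qed
    have le: "ennreal l * emeasure M (A n) \<le> emeasure M (W \<inter> A n)" for n
    proof -
      have "ennreal l * emeasure M (A n) = (\<integral>\<^sup>+\<omega>\<in>A n. ennreal l \<partial>M)"
        by (simp add: nn_integral_cmult_indicator)
      also have "\<dots> \<le> (\<integral>\<^sup>+\<omega>\<in>A n. ennreal (q n \<omega>) \<partial>M)"
        by (intro nn_integral_mono)
          (auto simp: A_def indicator_def split: if_splits intro!: ennreal_leI)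
      finally show ?thesis using cond[OF A] by simp
    qed
    have "ennreal l * emeasure M (\<Union>n. A n) = (\<Sum>n. ennreal l * emeasure M (A n))"
      by (subst suminf_emeasure[symmetric]) (auto simp: disj)
    also have "\<dots> \<le> (\<Sum>n. emeasure M (W \<inter> A n))"
      by (intro suminf_le le) auto
    also have "\<dots> = emeasure M (\<Union>n. W \<inter> A n)"
      using disj by (intro suminf_emeasure) (auto simp: disjoint_family_on_def)
    also have "\<dots> \<le> emeasure M (sym_diff W B)"
      by (intro emeasure_mono) (auto simp: A_def split: if_splits)
    finally have "ennreal (l * measure M (\<Union>n. A n)) \<le> ennreal (measure M (sym_diff W B))"
      using l by (simp add: emeasure_eq_measure ennreal_mult')
    then have "l * measure M (\<Union>n. A n) \<le> \<delta>" using B(2) by (simp add: ennreal_le_iff)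
    then have meas_A: "measure M (\<Union>n. A n) \<le> \<delta> / l" using l by (simp add: field_simps)
    have sub: "{\<omega> \<in> space M. \<exists>\<^sub>F n in sequentially. l < q n \<omega>} - W \<subseteq> sym_diff W B \<union> (\<Union>n. A n)"
    proof (rule subsetI, rule ccontr)
      fix \<omega> assume "\<omega> \<in> {\<omega> \<in> space M. \<exists>\<^sub>F n in sequentially. l < q n \<omega>} - W"
        and no: "\<omega> \<notin> sym_diff W B \<union> (\<Union>n. A n)"
      then have \<omega>: "\<omega> \<in> space M" "\<exists>\<^sub>F n in sequentially. l < q n \<omega>" "\<omega> \<notin> W" "\<omega> \<notin> B" by auto
      from \<omega>(2) have "\<exists>n. m \<le> n \<and> l < q n \<omega>" by (auto simp: frequently_sequentially)
      then obtain n where n: "m \<le> n \<and> l < q n \<omega>" "\<And>j. j < n \<Longrightarrow> \<not> (m \<le> j \<and> l < q j \<omega>)"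
        using exists_least_iff[of "\<lambda>n. m \<le> n \<and> l < q n \<omega>"] by blast
      then have "\<omega> \<in> A n" using \<omega> by (auto simp: A_def)
      with no show False by auto
    qed
    have "measure M ({\<omega> \<in> space M. \<exists>\<^sub>F n in sequentially. l < q n \<omega>} - W)
        \<le> measure M (sym_diff W B) + measure M (\<Union>n. A n)"
      by (rule measure_le_of_subset_Un[OF sub]) auto
    then show ?thesis using B(2) meas_A by linarith
  qed
  have "AE \<omega> in M. \<omega> \<notin> W \<longrightarrow> (\<forall>\<^sub>F n in sequentially. \<not> 1 / real (Suc j) < q n \<omega>)" for j
  proof -
    let ?l = "1 / real (Suc j)" let ?C = "{\<omega> \<in> space M. \<exists>\<^sub>F n in sequentially. ?l < q n \<omega>} - W"
    have [measurable]: "?C \<in> sets M" unfolding frequently_sequentially by measurable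
    have "measure M ?C \<le> 0"
    proof (rule field_le_epsilon)
      fix e :: real assume e: "e > 0"
      have pos: "2 + real j > 0" by simp
      \<comment> \<open>\<open>\<delta> = e / (2 + j)\<close> makes \<open>\<delta> + \<delta> / l\<close> equal to \<open>e\<close> for \<open>l = 1 / (j + 1)\<close>\<close>
      have "measure M ?C \<le> e / (2 + real j) + e / (2 + real j) / ?l"
        using e by (intro main) auto
      also have "\<dots> = e / (2 + real j) * (2 + real j)"
        by (simp only: divide_divide_eq_right div_by_1 of_nat_Suc distrib_left) simp
      also have "\<dots> = e" using pos by simp
      finally show "measure M ?C \<le> 0 + e" by simp
    qed
    then have "measure M ?C = 0" using measure_nonneg[of M ?C] by linarith
    then have "emeasure M ?C = 0" by (simp only: emeasure_eq_measure ennreal_0)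
    then have "?C \<in> null_sets M" by (rule null_setsI) measurable
    then show ?thesis by (rule AE_I') (auto simp: not_eventually)
  qed
  then have "AE \<omega> in M. \<forall>j. \<omega> \<notin> W \<longrightarrow> (\<forall>\<^sub>F n in sequentially. \<not> 1 / real (Suc j) < q n \<omega>)"
    unfolding AE_all_countable by blast
  then show ?thesis using AE_space
  proof eventually_elim
    case (elim \<omega>)
    show ?case
    proof (intro impI, rule order_tendstoI)
      fix a :: real assume "a < 0"
      then show "\<forall>\<^sub>F n in sequentially. a < q n \<omega>"
        using q(2)[OF elim(2)] by (intro always_eventually allI less_le_trans[OF \<open>a < 0\<close>])
    next
      fix a :: real assume W: "\<omega> \<notin> W" and "0 < a"
      then obtain j where j: "1 / real (Suc j) < a"
        using reals_Archimedean[OF \<open>0 < a\<close>] by (auto simp: inverse_eq_divide)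
      have "\<forall>\<^sub>F n in sequentially. \<not> 1 / real (Suc j) < q n \<omega>" using elim W by blast
      then show "\<forall>\<^sub>F n in sequentially. q n \<omega> < a"
        by eventually_elim (use j in linarith)
    qed
  qed
qed

section \<open>Compact sets inside Borel images\<close>

text \<open>
  The push-forward of \<open>\<nu>\<close> to the graph of \<open>\<tau>\<close> is inner regular. A compact piece of the graph over \<open>B\<close>
  projects to a compact subset of \<open>\<tau> ` B\<close>, while the image of \<open>B\<close> itself need not be Borel. The maps
  \<open>e\<close> and \<open>d\<close> embed the domain measurably into a complete space, on which inner regularity holds.
\<close>

lemma inner_compact_image:
  fixes \<tau> :: "'a::topological_space \<Rightarrow> 't::{second_countable_topology, complete_space}"
    and e :: "'a \<Rightarrow> 'p::{second_countable_topology, complete_space}"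
  assumes \<nu>: "finite_measure \<nu>" "sets \<nu> = sets borel"
    and e[measurable]: "e \<in> borel_measurable borel" and d[measurable]: "d \<in> borel \<rightarrow>\<^sub>M borel"
    and de: "\<And>s. d (e s) = s"
    and \<tau>[measurable]: "\<tau> \<in> borel_measurable borel" and B[measurable]: "B \<in> sets borel" and "\<delta> > 0"
  obtains C where "compact C" "C \<subseteq> \<tau> ` B" "measure \<nu> (B - \<tau> -` C) < \<delta>"
proof -
  interpret \<nu>: finite_measure \<nu> by fact
  have [measurable_cong]: "sets \<nu> = sets borel" by fact
  have sp: "space \<nu> = UNIV" using sets_eq_imp_space_eq[OF \<nu>(2)] by simp
  define g where "g s = (e s, \<tau> s)" for s
  have g[measurable]: "g \<in> \<nu> \<rightarrow>\<^sub>M borel" unfolding g_def by measurable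
  define \<mu> where "\<mu> = distr \<nu> borel g"
  interpret \<mu>: finite_measure \<mu> unfolding \<mu>_def by (rule \<nu>.finite_measure_distr) simp
  \<comment> \<open>the graph of \<open>\<tau>\<close> over \<open>B\<close>, written through \<open>d\<close> so that it is visibly Borel\<close>
  define H where "H = {z. e (d (fst z)) = fst z \<and> d (fst z) \<in> B \<and> snd z = \<tau> (d (fst z))}"
  have [measurable]: "fst \<in> (borel :: ('p \<times> 't) measure) \<rightarrow>\<^sub>M borel"
    "snd \<in> (borel :: ('p \<times> 't) measure) \<rightarrow>\<^sub>M borel"
    unfolding borel_prod[symmetric] by measurable
  have H: "H \<in> sets borel"
  proof -
    have "{z \<in> space borel. e (d (fst z)) = fst z \<and> d (fst z) \<in> B \<and> snd z = \<tau> (d (fst z))}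
        \<in> sets (borel :: ('p \<times> 't) measure)"
      by measurable
    then show ?thesis by (simp add: H_def)
  qed
  have \<mu>s[simp]: "sets \<mu> = sets borel" by (simp add: \<mu>_def)
  have sup: "emeasure \<mu> H = (SUP K \<in> {K. K \<subseteq> H \<and> compact K}. emeasure \<mu> K)"
    using \<mu>.finite_emeasure_space by (intro inner_regular[OF \<mu>s _ H]) (simp add: infinity_ennreal_def)
  obtain K where K: "K \<subseteq> H" "compact K" "measure \<mu> H - \<delta> < measure \<mu> K"
  proof (cases "measure \<mu> H < \<delta>")
    case True
    then show ?thesis by (intro that[of "{}"]) auto
  next
    case False
    then have "ennreal (measure \<mu> H - \<delta>) < ennreal (measure \<mu> H)"
      using \<open>\<delta> > 0\<close> by (intro ennreal_lessI) auto
    then obtain K where "K \<subseteq> H" "compact K" "ennreal (measure \<mu> H - \<delta>) < emeasure \<mu> K"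
      unfolding \<mu>.emeasure_eq_measure[symmetric] sup less_SUP_iff by auto
    moreover from this(3) have "measure \<mu> H - \<delta> < measure \<mu> K"
      using False by (simp add: \<mu>.emeasure_eq_measure ennreal_less_iff)
    ultimately show ?thesis by (intro that) auto
  qed
  have Ks[measurable]: "K \<in> sets borel" using K(2) by (intro borel_compact)
  define C where "C = snd ` K"
  have C: "compact C" unfolding C_def using K(2)
    by (intro compact_continuous_image continuous_intros)
  then have [measurable]: "C \<in> sets borel" by (rule borel_compact)
  show thesis
  proof (rule that[OF C])
    show "C \<subseteq> \<tau> ` B" using K(1) by (auto simp: C_def H_def)
    have "measure \<nu> (B - \<tau> -` C) \<le> measure \<nu> (g -` (H - K) \<inter> space \<nu>)"
    proof (rule \<nu>.finite_measure_mono)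
      show "B - \<tau> -` C \<subseteq> g -` (H - K) \<inter> space \<nu>"
      proof
        fix s assume s: "s \<in> B - \<tau> -` C"
        have "g s \<in> H" using s by (simp add: g_def H_def de)
        moreover have "g s \<notin> K"
        proof
          assume "g s \<in> K"
          then have "\<tau> s \<in> C" unfolding C_def by (rule image_eqI[rotated]) (simp add: g_def)
          with s show False by simp
        qed
        ultimately show "s \<in> g -` (H - K) \<inter> space \<nu>" by (simp add: sp)
      qed
    qed (use H in measurable)
    also have "\<dots> = measure \<mu> (H - K)"
      using H by (simp add: \<mu>_def measure_distr)
    also have "\<dots> = measure \<mu> H - measure \<mu> K"
      using H K(1) by (intro \<mu>.finite_measure_Diff) auto
    also have "\<dots> < \<delta>" using K(3) by simp
    finally show "measure \<nu> (B - \<tau> -` C) < \<delta>" .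
  qed
qed

section \<open>The topology of the parameter space\<close>

lemma d_Theta_eq:
  "d_Theta \<theta> \<theta>' = (if fst \<theta> = fst \<theta>' then
     min (sqrt ((L2_set (\<lambda>i. fst (snd \<theta>) i - fst (snd \<theta>') i) {..<fst \<theta>})\<^sup>2
       + (L2_set (\<lambda>i. norm (snd (snd \<theta>) i - snd (snd \<theta>') i)) {..<fst \<theta>})\<^sup>2)) 1 else 1)"
  by (cases \<theta>; cases \<theta>') (simp add: L2_set_def sum_nonneg)

lemma continuous_on_param_coordinates [continuous_intros]:
  "continuous_on A (\<lambda>\<theta> :: 'v::topological_space param. fst (snd \<theta>) i)"
  "continuous_on A (\<lambda>\<theta> :: 'v param. snd (snd \<theta>) i)"
  by (rule continuous_on_product_then_coordinatewise,
      intro continuous_on_fst continuous_on_snd continuous_on_id)+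

lemma open_d_Theta_ball:
  fixes \<theta>\<^sub>0 :: "'v::real_normed_vector param"
  shows "open {\<theta>. d_Theta \<theta>\<^sub>0 \<theta> < r}"
proof (cases "r > 1")
  case True
  then have "{\<theta>. d_Theta \<theta>\<^sub>0 \<theta> < r} = UNIV" by (auto simp: d_Theta_eq)
  then show ?thesis by simp
next
  case False
  define k where "k = fst \<theta>\<^sub>0"
  have "{\<theta>. d_Theta \<theta>\<^sub>0 \<theta> < r} = (fst -` {k}) \<inter>
      {\<theta>. sqrt ((\<Sum>i<k. (fst (snd \<theta>\<^sub>0) i - fst (snd \<theta>) i)\<^sup>2)
        + (\<Sum>i<k. (norm (snd (snd \<theta>\<^sub>0) i - snd (snd \<theta>) i))\<^sup>2)) < r}"
    using False by (auto simp: d_Theta_eq k_def L2_set_def sum_nonneg min_less_iff_disj)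
  moreover have "open (fst -` {k} :: 'v param set)"
    by (intro open_vimage_fst discrete_topology_class.open_discrete)
  ultimately show ?thesis
    by (auto intro!: open_Int open_Collect_less continuous_intros)
qed

lemma d_Theta_coordinates:
  assumes "d_Theta \<theta> \<theta>' < r" "r \<le> 1"
  shows "fst \<theta> = fst \<theta>'" "i < fst \<theta> \<Longrightarrow> dist (fst (snd \<theta>) i) (fst (snd \<theta>') i) < r"
    "i < fst \<theta> \<Longrightarrow> dist (snd (snd \<theta>) i) (snd (snd \<theta>') i) < r"
proof -
  show eq: "fst \<theta> = fst \<theta>'" using assms by (auto simp: d_Theta_eq split: if_splits)
  define a b where "a = L2_set (\<lambda>i. fst (snd \<theta>) i - fst (snd \<theta>') i) {..<fst \<theta>}"
    and "b = L2_set (\<lambda>i. norm (snd (snd \<theta>) i - snd (snd \<theta>') i)) {..<fst \<theta>}"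
  have "sqrt (a\<^sup>2 + b\<^sup>2) < r" using assms eq by (auto simp: d_Theta_eq a_def b_def)
  then have a: "a < r" and b: "b < r"
    using real_sqrt_sum_squares_ge1[of a b] real_sqrt_sum_squares_ge2[of b a] by linarith+
  {
    assume i: "i < fst \<theta>"
    have "\<bar>fst (snd \<theta>) i - fst (snd \<theta>') i\<bar> = L2_set (\<lambda>i. fst (snd \<theta>) i - fst (snd \<theta>') i) {i}"
      by simp
    also have "\<dots> \<le> a" unfolding a_def L2_set_def
      using i by (intro real_sqrt_le_mono sum_mono2) auto
    finally show "dist (fst (snd \<theta>) i) (fst (snd \<theta>') i) < r" using a by (simp add: dist_real_def)
    have "norm (snd (snd \<theta>) i - snd (snd \<theta>') i) = L2_set (\<lambda>i. norm (snd (snd \<theta>) i - snd (snd \<theta>') i)) {i}"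
      by simp
    also have "\<dots> \<le> b" unfolding b_def L2_set_def
      using i by (intro real_sqrt_le_mono sum_mono2) auto
    finally show "dist (snd (snd \<theta>) i) (snd (snd \<theta>') i) < r" using b by (simp add: dist_norm)
  }
qed

lemma ThetaD:
  assumes "\<theta> \<in> Theta V"
  shows "1 \<le> fst \<theta>" "i < fst \<theta> \<Longrightarrow> snd (snd \<theta>) i \<in> V"
    "\<not> i < fst \<theta> \<Longrightarrow> fst (snd \<theta>) i = undefined" "\<not> i < fst \<theta> \<Longrightarrow> snd (snd \<theta>) i = undefined"
    "i < fst \<theta> \<Longrightarrow> 0 < fst (snd \<theta>) i" "(\<Sum>i<fst \<theta>. fst (snd \<theta>) i) = 1"
  using assms by (auto simp: Theta_def Delta_def PiE_iff extensional_def)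

lemma Theta_iff:
  "\<theta> \<in> Theta V \<longleftrightarrow> 1 \<le> fst \<theta> \<and> fst (snd \<theta>) \<in> Delta (fst \<theta>) \<and> snd (snd \<theta>) \<in> PiE {..<fst \<theta>} (\<lambda>_. V)"
  by (cases \<theta>) (auto simp: Theta_def)

lemma Metric_space_Theta:
  fixes V :: "'v::real_normed_vector set"
  shows "Metric_space (Theta V) d_Theta"
proof
  fix x y z :: "'v param"
  show "0 \<le> d_Theta x y" by (auto simp: d_Theta_eq)
  show "d_Theta x y = d_Theta y x"
    by (auto simp: d_Theta_eq L2_set_def power2_commute norm_minus_commute)
  show "d_Theta x z \<le> d_Theta x y + d_Theta y z"
  proof (cases "fst x = fst y \<and> fst y = fst z")
    case True
    define a where "a = (\<lambda>(x :: 'v param) (y :: 'v param). L2_set (\<lambda>i. fst (snd x) i - fst (snd y) i) {..<fst z})"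
    define b where "b = (\<lambda>(x :: 'v param) (y :: 'v param). L2_set (\<lambda>i. norm (snd (snd x) i - snd (snd y) i)) {..<fst z})"
    have a: "a x z \<le> a x y + a y z"
      using L2_set_triangle_ineq[of "\<lambda>i. fst (snd x) i - fst (snd y) i" "\<lambda>i. fst (snd y) i - fst (snd z) i"]
      by (simp add: a_def)
    have "b x z \<le> L2_set (\<lambda>i. norm (snd (snd x) i - snd (snd y) i) + norm (snd (snd y) i - snd (snd z) i)) {..<fst z}"
      unfolding b_def
    proof (intro L2_set_mono)
      fix i show "norm (snd (snd x) i - snd (snd z) i)
          \<le> norm (snd (snd x) i - snd (snd y) i) + norm (snd (snd y) i - snd (snd z) i)"
        using norm_triangle_ineq[of "snd (snd x) i - snd (snd y) i" "snd (snd y) i - snd (snd z) i"]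
        by simp
    qed simp
    also have "\<dots> \<le> b x y + b y z" unfolding b_def by (rule L2_set_triangle_ineq)
    finally have b: "b x z \<le> b x y + b y z" .
    have nn: "0 \<le> a x y" "0 \<le> b x y" for x y by (auto simp: a_def b_def)
    have "sqrt ((a x z)\<^sup>2 + (b x z)\<^sup>2) \<le> sqrt ((a x y + a y z)\<^sup>2 + (b x y + b y z)\<^sup>2)"
      using a b nn by (intro real_sqrt_le_mono add_mono power_mono) auto
    also have "\<dots> \<le> sqrt ((a x y)\<^sup>2 + (b x y)\<^sup>2) + sqrt ((a y z)\<^sup>2 + (b y z)\<^sup>2)"
      by (rule real_sqrt_sum_squares_triangle_ineq)
    finally have "sqrt ((a x z)\<^sup>2 + (b x z)\<^sup>2) \<le> \<dots>" .
    moreover have "sqrt ((a x y)\<^sup>2 + (b x y)\<^sup>2) \<ge> 0" "sqrt ((a y z)\<^sup>2 + (b y z)\<^sup>2) \<ge> 0" by auto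
    ultimately have "min (sqrt ((a x z)\<^sup>2 + (b x z)\<^sup>2)) 1
        \<le> min (sqrt ((a x y)\<^sup>2 + (b x y)\<^sup>2)) 1 + min (sqrt ((a y z)\<^sup>2 + (b y z)\<^sup>2)) 1"
      by linarith
    then show ?thesis using True by (simp add: d_Theta_eq a_def b_def)
  next
    case False
    have "d_Theta x z \<le> 1" "0 \<le> d_Theta x y" "0 \<le> d_Theta y z" by (auto simp: d_Theta_eq)
    moreover have "d_Theta x y = 1 \<or> d_Theta y z = 1" using False by (auto simp: d_Theta_eq)
    ultimately show ?thesis by linarith
  qed
  assume x: "x \<in> Theta V" and y: "y \<in> Theta V"
  show "d_Theta x y = 0 \<longleftrightarrow> x = y"
  proof
    assume "d_Theta x y = 0"
    then have d: "d_Theta x y < r" if "r > 0" for r using that by simp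
    have k: "fst x = fst y" using d_Theta_coordinates(1)[OF d[of 1]] by simp
    have "fst (snd x) i = fst (snd y) i" for i
    proof (cases "i < fst x")
      case True
      show ?thesis
      proof (rule ccontr)
        assume "fst (snd x) i \<noteq> fst (snd y) i"
        then have "0 < min 1 (dist (fst (snd x) i) (fst (snd y) i))" by simp
        from d_Theta_coordinates(2)[OF d[OF this] _ True] show False by simp
      qed
    qed (use ThetaD[OF x] ThetaD[OF y] k in auto)
    moreover have "snd (snd x) i = snd (snd y) i" for i
    proof (cases "i < fst x")
      case True
      show ?thesis
      proof (rule ccontr)
        assume "snd (snd x) i \<noteq> snd (snd y) i"
        then have "0 < min 1 (dist (snd (snd x) i) (snd (snd y) i))" by simp
        from d_Theta_coordinates(3)[OF d[OF this] _ True] show False by simp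
      qed
    qed (use ThetaD[OF x] ThetaD[OF y] k in auto)
    ultimately show "x = y" using k by (auto simp: prod_eq_iff fun_eq_iff)
  qed (simp add: d_Theta_eq L2_set_def)
qed

lemma tendsto_fun_iff:
  fixes f :: "'a \<Rightarrow> 'i \<Rightarrow> 'b::topological_space"
  shows "(f \<longlongrightarrow> l) F \<longleftrightarrow> (\<forall>i. ((\<lambda>x. f x i) \<longlongrightarrow> l i) F)"
  using limitin_componentwise[of "\<lambda>_. euclidean :: 'b topology" UNIV f l F]
  by (simp add: euclidean_product_topology)

text \<open>
  On \<open>Theta V\<close> the coordinates beyond the number of components are all \<open>undefined\<close>, so convergence for
  the metric implies convergence of every coordinate, hence convergence in the product topology.
\<close>

lemma open_contains_d_Theta_ball:
  assumes U: "open U" "\<theta>\<^sub>0 \<in> U" and \<theta>\<^sub>0: "\<theta>\<^sub>0 \<in> Theta V"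
  obtains r where "r > 0" "\<And>\<theta>. \<theta> \<in> Theta V \<Longrightarrow> d_Theta \<theta>\<^sub>0 \<theta> < r \<Longrightarrow> \<theta> \<in> U"
proof (rule ccontr)
  assume "\<not> thesis"
  with that have "\<exists>\<theta>. \<theta> \<in> Theta V \<and> d_Theta \<theta>\<^sub>0 \<theta> < 1 / real (Suc n) \<and> \<theta> \<notin> U" for n
    by (metis of_nat_0_less_iff zero_less_Suc zero_less_divide_1_iff)
  then obtain t where t: "\<And>n. t n \<in> Theta V" "\<And>n. d_Theta \<theta>\<^sub>0 (t n) < 1 / real (Suc n)" "\<And>n. t n \<notin> U"
    by metis
  have k: "fst (t n) = fst \<theta>\<^sub>0" for n using d_Theta_coordinates(1)[OF t(2)[of n]] by simp
  have lim: "(\<lambda>n. x n) \<longlonglongrightarrow> y" if "\<And>n. dist y (x n) < 1 / real (Suc n)" for x and y :: "'b::metric_space"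
  proof (rule metric_LIMSEQ_I)
    fix r :: real assume "r > 0"
    then obtain N where N: "1 / real (Suc N) < r" using reals_Archimedean[of r] by (auto simp: inverse_eq_divide)
    have "dist (x n) y < r" if "n \<ge> N" for n
    proof -
      have "1 / real (Suc n) \<le> 1 / real (Suc N)" using that by (intro divide_left_mono) auto
      with \<open>dist y (x n) < 1 / real (Suc n)\<close> N show ?thesis by (simp add: dist_commute)
    qed
    then show "\<exists>N. \<forall>n\<ge>N. dist (x n) y < r" by blast
  qed
  have "(\<lambda>n. fst (snd (t n)) i) \<longlonglongrightarrow> fst (snd \<theta>\<^sub>0) i" for i
  proof (cases "i < fst \<theta>\<^sub>0")
    case True
    then show ?thesis by (intro lim d_Theta_coordinates(2)[OF t(2)]) auto
  qed (use ThetaD[OF \<theta>\<^sub>0] ThetaD[OF t(1)] k in simp)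
  moreover have "(\<lambda>n. snd (snd (t n)) i) \<longlonglongrightarrow> snd (snd \<theta>\<^sub>0) i" for i
  proof (cases "i < fst \<theta>\<^sub>0")
    case True
    then show ?thesis by (intro lim d_Theta_coordinates(3)[OF t(2)]) auto
  qed (use ThetaD[OF \<theta>\<^sub>0] ThetaD[OF t(1)] k in simp)
  ultimately have "(\<lambda>n. (fst \<theta>\<^sub>0, fst (snd (t n)), snd (snd (t n)))) \<longlonglongrightarrow> (fst \<theta>\<^sub>0, fst (snd \<theta>\<^sub>0), snd (snd \<theta>\<^sub>0))"
    by (intro tendsto_Pair tendsto_const) (auto simp: tendsto_fun_iff)
  moreover have "(fst \<theta>\<^sub>0, fst (snd (t n)), snd (snd (t n))) = t n" for n
    using k by (simp add: prod_eq_iff)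
  ultimately have "t \<longlonglongrightarrow> \<theta>\<^sub>0" by simp
  from topological_tendstoD[OF this U] have "\<exists>n. t n \<in> U"
    unfolding eventually_sequentially by blast
  then show False using t(3) by blast
qed

text \<open>
  The metric topology is the one that the parameter type induces as a product of types. Together with
  \<open>sets_Theta_borel\<close> below, this makes the measurability results for \<open>borel\<close> available.
\<close>

lemma openin_Theta_iff:
  "openin (Metric_space.mtopology (Theta V) d_Theta) U \<longleftrightarrow> (\<exists>O'. open O' \<and> U = Theta V \<inter> O')"
proof -
  interpret Metric_space "Theta V" d_Theta by (rule Metric_space_Theta)
  show ?thesis
  proof
    assume U: "openin mtopology U"
    define O' where "O' = \<Union>{W. open W \<and> Theta V \<inter> W \<subseteq> U}"
    have "U \<subseteq> Theta V \<inter> O'"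
    proof
      fix \<theta> assume "\<theta> \<in> U"
      then obtain r where r: "\<theta> \<in> Theta V" "r > 0" "mball \<theta> r \<subseteq> U"
        using U unfolding openin_mtopology by blast
      have "open {\<theta>'. d_Theta \<theta> \<theta>' < r}" by (rule open_d_Theta_ball)
      moreover have "Theta V \<inter> {\<theta>'. d_Theta \<theta> \<theta>' < r} \<subseteq> U" using r by auto
      moreover have "d_Theta \<theta> \<theta> < r" using r by simp
      ultimately show "\<theta> \<in> Theta V \<inter> O'" using r(1) by (auto simp: O'_def)
    qed
    moreover have "Theta V \<inter> O' \<subseteq> U" by (auto simp: O'_def)
    moreover have "open O'" unfolding O'_def by (intro open_Union) auto
    ultimately show "\<exists>O'. open O' \<and> U = Theta V \<inter> O'" by blast
  next
    assume "\<exists>O'. open O' \<and> U = Theta V \<inter> O'"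
    then obtain O' where O': "open O'" "U = Theta V \<inter> O'" by blast
    show "openin mtopology U" unfolding openin_mtopology
    proof (intro conjI allI impI)
      fix \<theta> assume "\<theta> \<in> U"
      then have \<theta>: "\<theta> \<in> O'" "\<theta> \<in> Theta V" using O' by auto
      obtain r where "r > 0" "\<And>\<theta>'. \<theta>' \<in> Theta V \<Longrightarrow> d_Theta \<theta> \<theta>' < r \<Longrightarrow> \<theta>' \<in> O'"
        using open_contains_d_Theta_ball[OF O'(1) \<theta>] by blast
      then show "\<exists>r>0. mball \<theta> r \<subseteq> U" using O'(2) by (intro exI[of _ r]) auto
    qed (use O' in auto)
  qed
qed

lemma param_measurable [measurable]:
  "fst \<in> (borel :: 'v::second_countable_topology param measure) \<rightarrow>\<^sub>M count_space UNIV"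
  "(\<lambda>\<theta> :: 'v param. fst (snd \<theta>) i) \<in> borel_measurable borel"
  "(\<lambda>\<theta> :: 'v param. snd (snd \<theta>) i) \<in> borel_measurable borel"
proof -
  have "fst -` {k} \<in> sets (borel :: 'v param measure)" for k
    by (intro borel_open open_vimage_fst discrete_topology_class.open_discrete)
  then show "fst \<in> (borel :: 'v param measure) \<rightarrow>\<^sub>M count_space UNIV"
    by (simp add: measurable_count_space_eq2_countable)
qed (intro borel_measurable_continuous_onI continuous_on_param_coordinates)+

lemma Theta_borel_set:
  assumes [measurable]: "V \<in> sets borel"
  shows "Theta (V :: 'v::{real_normed_vector, second_countable_topology} set) \<in> sets borel"
proof -
  have "Theta V = {\<theta> \<in> space borel. 1 \<le> fst \<theta> \<and>
      (\<forall>i. (i < fst \<theta> \<longrightarrow> 0 < fst (snd \<theta>) i \<and> fst (snd \<theta>) i \<le> 1 \<and> snd (snd \<theta>) i \<in> V) \<and>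
        (\<not> i < fst \<theta> \<longrightarrow> fst (snd \<theta>) i = undefined \<and> snd (snd \<theta>) i = undefined)) \<and>
      (\<forall>k. fst \<theta> = k \<longrightarrow> (\<Sum>i<k. fst (snd \<theta>) i) = 1)}"
    by (auto simp: Theta_iff Delta_def PiE_iff extensional_def)
  also have "\<dots> \<in> sets borel" by measurable
  finally show ?thesis .
qed

lemma
  fixes V :: "'v::{real_normed_vector, second_countable_topology} set"
  assumes V: "V \<in> sets borel"
  shows space_Theta_borel [simp]: "space (Theta_borel V) = Theta V"
    and sets_Theta_borel: "sets (Theta_borel V) = sets (restrict_space borel (Theta V))"
proof -
  have sub: "{U. openin (Metric_space.mtopology (Theta V) d_Theta) U} = (\<inter>) (Theta V) ` {S. open S}"
    by (auto simp: openin_Theta_iff)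
  show "space (Theta_borel V) = Theta V"
    unfolding Theta_borel_def sub by (subst space_measure_of) auto
  have "sets (Theta_borel V) = sigma_sets (Theta V) ((\<inter>) (Theta V) ` {S. open S})"
    unfolding Theta_borel_def sub by (subst sets_measure_of) auto
  also have "\<dots> = (\<inter>) (Theta V) ` sigma_sets UNIV {S. open S}"
    using Theta_borel_set[OF V] by (intro sigma_sets_Int[symmetric]) (auto simp: borel_def)
  also have "\<dots> = sets (restrict_space borel (Theta V))"
    by (simp add: sets_restrict_space borel_def)
  finally show "sets (Theta_borel V) = sets (restrict_space borel (Theta V))" .
qed

text \<open>
  With the number of components as a real coordinate, parameters live in a product of complete spaces,
  as \<open>inner_compact_image\<close> requires.
\<close>

definition encode :: "'v::second_countable_topology param \<Rightarrow> real \<times> (nat \<Rightarrow> real) \<times> (nat \<Rightarrow> 'v)" where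
  "encode \<theta> = (real (fst \<theta>), snd \<theta>)"

definition decode :: "real \<times> (nat \<Rightarrow> real) \<times> (nat \<Rightarrow> 'v::second_countable_topology) \<Rightarrow> 'v param" where
  "decode z = (nat \<lfloor>fst z\<rfloor>, snd z)"

lemma measurable_encode: "encode \<in> borel_measurable borel"
  unfolding encode_def[abs_def]
  by (intro borel_measurable_Pair measurable_compose[OF param_measurable(1)]
      borel_measurable_continuous_onI continuous_intros) simp

lemma measurable_decode:
  "(decode :: _ \<Rightarrow> 'v::second_countable_topology param) \<in> borel \<rightarrow>\<^sub>M borel"
proof -
  have "(\<lambda>z :: real \<times> (nat \<Rightarrow> real) \<times> (nat \<Rightarrow> 'v). nat \<lfloor>fst z\<rfloor>) \<in> borel \<rightarrow>\<^sub>M count_space UNIV"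
    by (intro measurable_compose[OF borel_measurable_continuous_onI[OF continuous_on_fst[OF continuous_on_id]]])
      measurable
  then have "(\<lambda>z :: real \<times> (nat \<Rightarrow> real) \<times> (nat \<Rightarrow> 'v). nat \<lfloor>fst z\<rfloor>) \<in> borel \<rightarrow>\<^sub>M borel"
    unfolding measurable_cong_sets[OF refl sets_borel_eq_count_space] .
  then show ?thesis unfolding decode_def[abs_def]
    by (intro borel_measurable_Pair borel_measurable_continuous_onI[of snd] continuous_intros)
qed

lemma decode_encode: "decode (encode \<theta>) = \<theta>"
  by (simp add: encode_def decode_def)

lemma fst_permute_param [simp]: "fst (permute_param \<theta> \<sigma>) = fst \<theta>"
  and fst_snd_permute_param [simp]: "fst (snd (permute_param \<theta> \<sigma>)) = fst (snd \<theta>) \<circ> \<sigma>"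
  and snd_snd_permute_param [simp]: "snd (snd (permute_param \<theta> \<sigma>)) = snd (snd \<theta>) \<circ> \<sigma>"
  by (cases \<theta>; simp)+

lemma permute_param_comp: "permute_param (permute_param \<theta> \<sigma>) \<rho> = permute_param \<theta> (\<sigma> \<circ> \<rho>)"
  by (simp add: prod_eq_iff comp_assoc)

lemma permute_param_id: "permute_param \<theta> id = \<theta>"
  by (simp add: prod_eq_iff fun_eq_iff)

lemma permute_param_Theta:
  assumes \<theta>: "\<theta> \<in> Theta V" and \<sigma>: "\<sigma> permutes {..<fst \<theta>}"
  shows "permute_param \<theta> \<sigma> \<in> Theta V"
proof -
  have lt: "\<sigma> i < fst \<theta> \<longleftrightarrow> i < fst \<theta>" for i using permutes_in_image[OF \<sigma>, of i] by simp
  have "(\<Sum>i<fst \<theta>. fst (snd \<theta>) (\<sigma> i)) = (\<Sum>i<fst \<theta>. fst (snd \<theta>) i)"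
    using sum.permute[OF \<sigma>, of "fst (snd \<theta>)"] by (simp add: comp_def)
  then show ?thesis using \<theta> lt unfolding Theta_iff Delta_def
    by (auto simp: PiE_iff extensional_def)
qed

lemma d_Theta_permute:
  assumes \<sigma>: "\<sigma> permutes {..<fst \<theta>}"
  shows "d_Theta (permute_param \<theta> \<sigma>) (permute_param \<theta>' \<sigma>) = d_Theta \<theta> \<theta>'"
proof -
  have "L2_set (\<lambda>i. f (\<sigma> i)) {..<fst \<theta>} = L2_set f {..<fst \<theta>}" for f
    unfolding L2_set_def using sum.permute[OF \<sigma>, of "\<lambda>i. (f i)\<^sup>2"] by (simp add: comp_def)
  from this[of "\<lambda>i. fst (snd \<theta>) i - fst (snd \<theta>') i"]
    this[of "\<lambda>i. norm (snd (snd \<theta>) i - snd (snd \<theta>') i)"]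
  show ?thesis
    by (simp only: d_Theta_eq fst_permute_param fst_snd_permute_param snd_snd_permute_param comp_apply)
qed

text \<open>
  The union of the orbits that meet \<open>W\<close>: the smallest permutation-invariant subset of \<open>Theta V\<close> that
  contains the parameters in \<open>W\<close>.
\<close>

definition orbit_meets :: "'v set \<Rightarrow> 'v param set \<Rightarrow> 'v param set" where
  "orbit_meets V W = {\<theta> \<in> Theta V. \<exists>\<sigma>. \<sigma> permutes {..<fst \<theta>} \<and> permute_param \<theta> \<sigma> \<in> W}"

lemma orbit_meets_permute:
  assumes "\<theta> \<in> orbit_meets V W" and \<sigma>: "\<sigma> permutes {..<fst \<theta>}"
  shows "permute_param \<theta> \<sigma> \<in> orbit_meets V W"
proof -
  obtain \<rho> where \<theta>: "\<theta> \<in> Theta V" and \<rho>: "\<rho> permutes {..<fst \<theta>}" "permute_param \<theta> \<rho> \<in> W"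
    using assms(1) by (auto simp: orbit_meets_def)
  have "permute_param (permute_param \<theta> \<sigma>) (inv \<sigma> \<circ> \<rho>) = permute_param \<theta> \<rho>"
    using permutes_inv_o(1)[OF \<sigma>] by (simp add: permute_param_comp o_assoc)
  then have "permute_param (permute_param \<theta> \<sigma>) (inv \<sigma> \<circ> \<rho>) \<in> W" using \<rho>(2) by simp
  moreover have "(inv \<sigma> \<circ> \<rho>) permutes {..<fst \<theta>}" by (rule permutes_compose[OF \<rho>(1) permutes_inv[OF \<sigma>]])
  ultimately show ?thesis using permute_param_Theta[OF \<theta> \<sigma>] unfolding orbit_meets_def by auto
qed

lemma measurable_permute_param:
  "(\<lambda>\<theta> :: 'v::second_countable_topology param. permute_param \<theta> \<sigma>) \<in> borel \<rightarrow>\<^sub>M borel"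
proof -
  have "(\<lambda>\<theta> :: 'v param. fst \<theta>) \<in> borel \<rightarrow>\<^sub>M borel"
    by (intro borel_measurable_continuous_onI continuous_intros)
  then have "(\<lambda>\<theta> :: 'v param. (fst \<theta>, (\<lambda>i. fst (snd \<theta>) (\<sigma> i)), (\<lambda>i. snd (snd \<theta>) (\<sigma> i)))) \<in> borel \<rightarrow>\<^sub>M borel"
    by (intro borel_measurable_Pair measurable_coordinatewise_then_product param_measurable)
  also have "(\<lambda>\<theta> :: 'v param. (fst \<theta>, (\<lambda>i. fst (snd \<theta>) (\<sigma> i)), (\<lambda>i. snd (snd \<theta>) (\<sigma> i)))) = (\<lambda>\<theta>. permute_param \<theta> \<sigma>)"
    by (simp add: fun_eq_iff prod_eq_iff)
  finally show ?thesis .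
qed

lemma orbit_meets_borel:
  fixes V :: "'v::{real_normed_vector, second_countable_topology} set"
  assumes V: "V \<in> sets borel" and W: "open W"
  shows "orbit_meets V W \<in> sets borel"
proof -
  have "(\<lambda>\<theta>. permute_param \<theta> \<sigma>) -` W \<in> sets borel" for \<sigma>
    using measurable_sets[OF measurable_permute_param borel_open[OF W]] by simp
  moreover have "fst -` {k} \<in> sets (borel :: 'v param measure)" for k
    using measurable_sets[OF param_measurable(1), of "{k}"] by simp
  moreover have "orbit_meets V W = Theta V \<inter>
      (\<Union>k. \<Union>\<sigma>\<in>{\<sigma>. \<sigma> permutes {..<k}}. fst -` {k} \<inter> (\<lambda>\<theta>. permute_param \<theta> \<sigma>) -` W)"
    by (auto simp: orbit_meets_def)
  ultimately show ?thesis using Theta_borel_set[OF V]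
    by (auto intro!: sets.Int sets.countable_UN sets.finite_UN finite_permutations)
qed

lemma orbit_meets_subset_Btilde:
  fixes V :: "'v::real_normed_vector set"
  assumes \<theta>\<^sub>0: "\<theta>\<^sub>0 \<in> Theta V" and W: "W \<subseteq> {\<theta>. d_Theta \<theta>\<^sub>0 \<theta> < \<epsilon>}" and \<epsilon>: "\<epsilon> \<le> 1"
  shows "orbit_meets V W \<subseteq> Btilde V \<theta>\<^sub>0 \<epsilon> \<inter> {\<theta> \<in> Theta V. ncomp \<theta> = ncomp \<theta>\<^sub>0}"
proof
  fix \<theta> assume "\<theta> \<in> orbit_meets V W"
  then obtain \<sigma> where \<theta>: "\<theta> \<in> Theta V" and \<sigma>: "\<sigma> permutes {..<fst \<theta>}" and d: "d_Theta \<theta>\<^sub>0 (permute_param \<theta> \<sigma>) < \<epsilon>"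
    using W by (auto simp: orbit_meets_def)
  have k: "fst \<theta>\<^sub>0 = fst \<theta>" using d_Theta_coordinates(1)[OF d \<epsilon>] by simp
  interpret Metric_space "Theta V" d_Theta by (rule Metric_space_Theta)
  have "d_Theta \<theta> (permute_param \<theta>\<^sub>0 (inv \<sigma>))
      = d_Theta (permute_param (permute_param \<theta> \<sigma>) (inv \<sigma>)) (permute_param \<theta>\<^sub>0 (inv \<sigma>))"
    using permutes_inv_o(1)[OF \<sigma>] by (simp add: permute_param_comp permute_param_id)
  also have "\<dots> = d_Theta (permute_param \<theta> \<sigma>) \<theta>\<^sub>0"
    using permutes_inv[OF \<sigma>] by (intro d_Theta_permute) simp
  also have "\<dots> < \<epsilon>" using d by (simp add: commute)
  finally have "d_Theta \<theta> (permute_param \<theta>\<^sub>0 (inv \<sigma>)) < \<epsilon>" .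
  then show "\<theta> \<in> Btilde V \<theta>\<^sub>0 \<epsilon> \<inter> {\<theta> \<in> Theta V. ncomp \<theta> = ncomp \<theta>\<^sub>0}"
    using \<theta> k permutes_inv[OF \<sigma>] by (auto simp: Btilde_def ncomp_def)
qed

lemma Btilde_measurable:
  fixes V :: "'v::{real_normed_vector, second_countable_topology} set"
  assumes V: "V \<in> sets borel"
  shows "Btilde V \<theta>\<^sub>0 \<epsilon> \<in> sets (Theta_borel V)"
proof -
  have "{\<theta> \<in> Theta V. d_Theta \<theta> \<theta>' < \<epsilon>} \<in> sets (Theta_borel V)" for \<theta>'
  proof -
    interpret Metric_space "Theta V" d_Theta by (rule Metric_space_Theta)
    have "{\<theta> \<in> Theta V. d_Theta \<theta> \<theta>' < \<epsilon>} = Theta V \<inter> {\<theta>. d_Theta \<theta>' \<theta> < \<epsilon>}"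
      by (auto simp: commute)
    then show ?thesis unfolding sets_Theta_borel[OF V] sets_restrict_space
      using borel_open[OF open_d_Theta_ball] by blast
  qed
  then show ?thesis unfolding Btilde_def by (intro sets.finite_UN finite_permutations) auto
qed

lemma ncomp_measurable:
  fixes V :: "'v::{real_normed_vector, second_countable_topology} set"
  assumes V: "V \<in> sets borel"
  shows "{\<theta> \<in> Theta V. ncomp \<theta> = k} \<in> sets (Theta_borel V)"
proof -
  have "{\<theta> \<in> Theta V. ncomp \<theta> = k} = Theta V \<inter> fst -` {k}" by (auto simp: ncomp_def)
  moreover have "fst -` {k} \<in> sets (borel :: 'v param measure)"
    using measurable_sets[OF param_measurable(1), of "{k}"] by simp
  ultimately show ?thesis unfolding sets_Theta_borel[OF V] sets_restrict_space by blast
qed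

section \<open>Finite mixtures\<close>

lemma sets_mixture [simp]: "sets (mixture N k w M) = sets N"
  and space_mixture [simp]: "space (mixture N k w M) = space N"
  using sets.space_closed[of N] by (auto simp: mixture_def)

lemma emeasure_mixture:
  assumes M: "\<And>i. i < k \<Longrightarrow> sets (M i) = sets N" and A: "A \<in> sets N"
  shows "emeasure (mixture N k w M) A = (\<Sum>i<k. ennreal (w i) * emeasure (M i) A)"
proof (rule emeasure_measure_of[OF mixture_def])
  show "countably_additive (sets (mixture N k w M)) (\<lambda>A. \<Sum>i<k. ennreal (w i) * emeasure (M i) A)"
  proof (rule countably_additiveI)
    fix B :: "nat \<Rightarrow> 'a set"
    assume B: "range B \<subseteq> sets (mixture N k w M)" "disjoint_family B"
    have "(\<Sum>j. \<Sum>i<k. ennreal (w i) * emeasure (M i) (B j))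
        = (\<Sum>i<k. \<Sum>j. ennreal (w i) * emeasure (M i) (B j))"
      by (rule suminf_sum) simp
    also have "\<dots> = (\<Sum>i<k. ennreal (w i) * emeasure (M i) (\<Union>j. B j))"
      using B M by (intro sum.cong refl) (simp add: ennreal_suminf_cmult suminf_emeasure)
    finally show "(\<Sum>j. \<Sum>i<k. ennreal (w i) * emeasure (M i) (B j))
      = (\<Sum>i<k. ennreal (w i) * emeasure (M i) (\<Union>j. B j))" .
  qed
qed (use A sets.space_closed[of N] in \<open>auto simp: positive_def\<close>)

lemma DeltaD:
  assumes "w \<in> Delta k"
  shows "i < k \<Longrightarrow> 0 < w i" "i < k \<Longrightarrow> 0 \<le> w i" "(\<Sum>i<k. w i) = 1"
    "\<not> i < k \<Longrightarrow> w i = undefined"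
  using assms by (auto simp: Delta_def PiE_iff extensional_def intro: less_imp_le)

lemma prob_space_mixture:
  assumes w: "w \<in> Delta k" and M: "\<And>i. i < k \<Longrightarrow> sets (M i) = sets N" "\<And>i. i < k \<Longrightarrow> prob_space (M i)"
  shows "prob_space (mixture N k w M)"
proof
  have "emeasure (M i) (space N) = 1" if "i < k" for i
    using prob_space.emeasure_space_1[OF M(2)[OF that]] sets_eq_imp_space_eq[OF M(1)[OF that]] by simp
  then show "emeasure (mixture N k w M) (space (mixture N k w M)) = 1"
    using DeltaD[OF w] by (simp add: emeasure_mixture M(1)) (subst sum_ennreal; simp)
qed

text \<open>
  With distinct points, the mass at \<open>v i\<close> is exactly \<open>w i > 0\<close>. Equal mixtures therefore have the same
  atoms, and matching equal atoms gives the permutation.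
\<close>

lemma mixture_return_identifiable:
  fixes V :: "'v::t1_space set"
  assumes w: "w \<in> Delta k" "w' \<in> Delta k'" and v: "v \<in> PiE {..<k} (\<lambda>_. V)" "v' \<in> PiE {..<k'} (\<lambda>_. V)"
    and inj: "inj_on v {..<k}" "inj_on v' {..<k'}"
    and eq: "mixture (restrict_space borel V) k w (\<lambda>i. return (restrict_space borel V) (v i)) =
      mixture (restrict_space borel V) k' w' (\<lambda>i. return (restrict_space borel V) (v' i))"
  obtains \<sigma> where "\<sigma> permutes {..<k'}" "(k, w, v) = permute_param (k', w', v') \<sigma>"
proof -
  let ?R = "restrict_space borel V :: 'v measure"
  let ?m = "\<lambda>k w v. emeasure (mixture ?R k w (\<lambda>i. return ?R (v i)))"
  have atom: "?m k w v {x} = (\<Sum>i<k. ennreal (w i) * indicator {x} (v i))" if "x \<in> V" for k w v x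
  proof -
    have "{x} \<in> sets ?R" using that by (auto simp: sets_restrict_space image_iff intro!: bexI[of _ "{x}"])
    then show ?thesis by (simp add: emeasure_mixture)
  qed
  have atom_v: "?m k w v {v i} = ennreal (w i)"
    if "i < k" "inj_on v {..<k}" "v \<in> PiE {..<k} (\<lambda>_. V)" for k w v i
  proof -
    have "v i \<in> V" using that by auto
    then have "?m k w v {v i} = (\<Sum>j<k. ennreal (w j) * indicator {v i} (v j))" by (rule atom)
    also have "\<dots> = (\<Sum>j<k. if j = i then ennreal (w i) else 0)"
      using that by (intro sum.cong refl) (auto simp: indicator_def inj_on_def)
    finally show ?thesis using that(1) by simp
  qed
  have atom_0: "?m k w v {x} = 0" if "x \<notin> v ` {..<k}" "x \<in> V" for k w v x
    using that by (auto simp: atom)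
  have "v ` {..<k} \<subseteq> v' ` {..<k'}"
  proof safe
    fix i assume i: "i < k"
    then have "v i \<in> V" using v by auto
    with i show "v i \<in> v' ` {..<k'}"
      using atom_v[OF i inj(1) v(1), of w] atom_0[of "v i" v' k' w'] DeltaD(1)[OF w(1) i] eq by auto
  qed
  moreover have "v' ` {..<k'} \<subseteq> v ` {..<k}"
  proof safe
    fix i assume i: "i < k'"
    then have "v' i \<in> V" using v by auto
    with i show "v' i \<in> v ` {..<k}"
      using atom_v[OF i inj(2) v(2), of w'] atom_0[of "v' i" v k w] DeltaD(1)[OF w(2) i] eq by auto
  qed
  ultimately have im: "v ` {..<k} = v' ` {..<k'}" by auto
  then have k: "k = k'" using card_image[OF inj(1)] card_image[OF inj(2)] by simp
  \<comment> \<open>outside \<open>{..<k}\<close> it is the identity, where both tuples are \<open>undefined\<close>\<close>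
  define \<sigma> where "\<sigma> i = (if i < k then the_inv_into {..<k'} v' (v i) else i)" for i
  have v'\<sigma>: "v' (\<sigma> i) = v i" and \<sigma>k: "\<sigma> i < k'" if "i < k" for i
  proof -
    have "v i \<in> v' ` {..<k'}" using im that by auto
    then show "v' (\<sigma> i) = v i" "\<sigma> i < k'"
      using f_the_inv_into_f[OF inj(2)] the_inv_into_into[OF inj(2), of "v i" "{..<k'}"] that
      by (auto simp: \<sigma>_def)
  qed
  have "inj_on \<sigma> {..<k'}"
    using inj(1) v'\<sigma> unfolding k[symmetric] inj_on_def by (metis lessThan_iff)
  moreover from this have "\<sigma> ` {..<k'} = {..<k'}"
    using \<sigma>k k by (intro endo_inj_surj) auto
  ultimately have "bij_betw \<sigma> {..<k'} {..<k'}" by (simp add: bij_betw_def)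
  then have perm: "\<sigma> permutes {..<k'}"
    by (rule bij_imp_permutes) (auto simp: \<sigma>_def k)
  have "v = v' \<circ> \<sigma>"
  proof
    fix i show "v i = (v' \<circ> \<sigma>) i"
      using v v'\<sigma> k by (cases "i < k") (auto simp: \<sigma>_def PiE_iff extensional_def)
  qed
  moreover have "w = w' \<circ> \<sigma>"
  proof
    fix i show "w i = (w' \<circ> \<sigma>) i"
    proof (cases "i < k")
      case True
      have "ennreal (w i) = ?m k w v {v i}" using atom_v[OF True inj(1) v(1)] by simp
      also have "\<dots> = ?m k' w' v' {v' (\<sigma> i)}" using eq v'\<sigma>[OF True] by simp
      also have "\<dots> = ennreal (w' (\<sigma> i))" by (rule atom_v[OF \<sigma>k[OF True] inj(2) v(2)])
      finally show ?thesis
        using DeltaD(2)[OF w(1) True] DeltaD(2)[OF w(2) \<sigma>k[OF True]] by simp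
    qed (use DeltaD(4)[OF w(1)] DeltaD(4)[OF w(2)] k in \<open>auto simp: \<sigma>_def\<close>)
  qed
  ultimately show thesis using that[OF perm] k by simp
qed

section \<open>Joint laws built from kernels\<close>

lemma measurable_PiM_kernel:
  assumes K: "K \<in> M \<rightarrow>\<^sub>M prob_algebra N"
  shows "(\<lambda>x. PiM (UNIV :: 'i set) (\<lambda>_. K x)) \<in> M \<rightarrow>\<^sub>M prob_algebra (PiM UNIV (\<lambda>_. N))"
proof (rule measurable_prob_algebra_generated[OF sets_PiM Int_stable_prod_algebra prod_algebra_sets_into_space])
  have K': "prob_space (K x)" "sets (K x) = sets N" if "x \<in> space M" for x
    using measurable_space[OF K that] by (auto simp: space_prob_algebra)
  show "prob_space (PiM UNIV (\<lambda>_. K x))" if "x \<in> space M" for x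
    using K' that by (intro prob_space_PiM)
  show "sets (PiM UNIV (\<lambda>_. K x)) = sets (PiM UNIV (\<lambda>_. N))" if "x \<in> space M" for x
    using K' that by (intro sets_PiM_cong) auto
  fix A assume "A \<in> prod_algebra (UNIV :: 'i set) (\<lambda>_. N)"
  then obtain J E where A: "A = prod_emb UNIV (\<lambda>_. N) J (Pi\<^sub>E J E)" "finite J"
      "\<And>i. i \<in> J \<Longrightarrow> E i \<in> sets N"
    by (elim prod_algebraE) auto
  have [measurable]: "K \<in> M \<rightarrow>\<^sub>M subprob_algebra N" by (rule measurable_prob_algebraD[OF K])
  have "(\<lambda>x. \<Prod>i\<in>J. emeasure (K x) (E i)) \<in> borel_measurable M"
    using A(3) by (intro borel_measurable_prod_ennreal) measurable
  also have "?this \<longleftrightarrow> (\<lambda>x. emeasure (PiM UNIV (\<lambda>_. K x)) A) \<in> borel_measurable M"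
  proof (rule measurable_cong)
    fix x assume x: "x \<in> space M"
    have "A = prod_emb UNIV (\<lambda>_. K x) J (Pi\<^sub>E J E)"
      using sets_eq_imp_space_eq[OF K'(2)[OF x]] by (simp add: A(1) prod_emb_def)
    then show "(\<Prod>i\<in>J. emeasure (K x) (E i)) = emeasure (PiM UNIV (\<lambda>_. K x)) A"
      using A K'[OF x] by (simp add: emeasure_PiM_emb)
  qed
  finally show "(\<lambda>x. emeasure (PiM UNIV (\<lambda>_. K x)) A) \<in> borel_measurable M" .
qed

lemma measurable_pair_kernel:
  assumes K: "K \<in> B \<rightarrow>\<^sub>M prob_algebra S"
  shows "(\<lambda>\<theta>. K \<theta> \<bind> (\<lambda>x. return (B \<Otimes>\<^sub>M S) (\<theta>, x))) \<in> B \<rightarrow>\<^sub>M prob_algebra (B \<Otimes>\<^sub>M S)"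
  by (rule measurable_bind_prob_space2[OF K]) (simp add: measurable_return_prob_space)

lemma pair_kernel_eq_distr:
  assumes "K \<in> B \<rightarrow>\<^sub>M prob_algebra S" "\<theta> \<in> space B"
  shows "K \<theta> \<bind> (\<lambda>x. return (B \<Otimes>\<^sub>M S) (\<theta>, x)) = distr (K \<theta>) (B \<Otimes>\<^sub>M S) (Pair \<theta>)"
proof -
  have "prob_space (K \<theta>)" and [measurable_cong]: "sets (K \<theta>) = sets S"
    using measurable_space[OF assms] by (auto simp: space_prob_algebra)
  then show ?thesis using assms(2)
    by (intro bind_return_distr' prob_space.not_empty) auto
qed

lemma
  assumes \<nu>: "\<nu> \<in> space (prob_algebra B)" and K: "K \<in> B \<rightarrow>\<^sub>M prob_algebra S"
  defines "J \<equiv> \<nu> \<bind> (\<lambda>\<theta>. K \<theta> \<bind> (\<lambda>x. return (B \<Otimes>\<^sub>M S) (\<theta>, x)))"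
  shows prob_space_joint: "prob_space J" and sets_joint: "sets J = sets (B \<Otimes>\<^sub>M S)"
    and emeasure_joint: "A \<in> sets (B \<Otimes>\<^sub>M S) \<Longrightarrow>
      emeasure J A = (\<integral>\<^sup>+\<theta>. emeasure (K \<theta>) (Pair \<theta> -` A) \<partial>\<nu>)"
    and AE_joint: "Measurable.pred (B \<Otimes>\<^sub>M S) P \<Longrightarrow>
      (AE z in J. P z) \<longleftrightarrow> (AE \<theta> in \<nu>. AE x in K \<theta>. P (\<theta>, x))"
    and distr_joint_fst: "distr J B fst = \<nu>"
proof -
  have \<nu>': "prob_space \<nu>" and \<nu>s[measurable_cong]: "sets \<nu> = sets B" using \<nu> by (auto simp: space_prob_algebra)
  have \<nu>sp: "space \<nu> = space B" using \<nu>s by (rule sets_eq_imp_space_eq)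
  have K': "prob_space (K \<theta>)" "sets (K \<theta>) = sets S" "space (K \<theta>) = space S" if "\<theta> \<in> space B" for \<theta>
    using measurable_space[OF K that] by (auto simp: space_prob_algebra dest: sets_eq_imp_space_eq)
  note J = measurable_pair_kernel[OF K]
  show pJ: "prob_space J" unfolding J_def by (rule prob_space_bind'[OF \<nu> J])
  show sJ: "sets J = sets (B \<Otimes>\<^sub>M S)" unfolding J_def by (rule sets_bind'[OF \<nu> J])
  show em: "emeasure J A = (\<integral>\<^sup>+\<theta>. emeasure (K \<theta>) (Pair \<theta> -` A) \<partial>\<nu>)"
    if A[measurable]: "A \<in> sets (B \<Otimes>\<^sub>M S)" for A
  proof -
    have "emeasure J A = (\<integral>\<^sup>+\<theta>. emeasure (K \<theta> \<bind> (\<lambda>x. return (B \<Otimes>\<^sub>M S) (\<theta>, x))) A \<partial>\<nu>)"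
      unfolding J_def by (rule emeasure_bind_prob_algebra[OF \<nu> J A])
    also have "\<dots> = (\<integral>\<^sup>+\<theta>. emeasure (K \<theta>) (Pair \<theta> -` A) \<partial>\<nu>)"
    proof (rule nn_integral_cong)
      fix \<theta> assume "\<theta> \<in> space \<nu>"
      then have \<theta>: "\<theta> \<in> space B" by (simp add: \<nu>sp)
      have [measurable_cong]: "sets (K \<theta>) = sets S" by (rule K'(2)[OF \<theta>])
      have "Pair \<theta> -` A \<subseteq> space (K \<theta>)"
        using sets.sets_into_space[OF A] by (auto simp: K'(3)[OF \<theta>] space_pair_measure)
      then show "emeasure (K \<theta> \<bind> (\<lambda>x. return (B \<Otimes>\<^sub>M S) (\<theta>, x))) A = emeasure (K \<theta>) (Pair \<theta> -` A)"
        using \<theta> by (simp add: pair_kernel_eq_distr[OF K \<theta>] emeasure_distr Int_absorb2)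
    qed
    finally show ?thesis .
  qed
  show "(AE z in J. P z) \<longleftrightarrow> (AE \<theta> in \<nu>. AE x in K \<theta>. P (\<theta>, x))"
    if P[measurable]: "Measurable.pred (B \<Otimes>\<^sub>M S) P"
  proof -
    have J': "(\<lambda>\<theta>. K \<theta> \<bind> (\<lambda>x. return (B \<Otimes>\<^sub>M S) (\<theta>, x))) \<in> \<nu> \<rightarrow>\<^sub>M subprob_algebra (B \<Otimes>\<^sub>M S)"
      using measurable_prob_algebraD[OF J] by (simp add: measurable_cong_sets[OF \<nu>s refl])
    have "(AE z in J. P z) \<longleftrightarrow>
        (AE \<theta> in \<nu>. AE z in K \<theta> \<bind> (\<lambda>x. return (B \<Otimes>\<^sub>M S) (\<theta>, x)). P z)"
      unfolding J_def by (rule AE_bind[OF J' P])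
    also have "\<dots> \<longleftrightarrow> (AE \<theta> in \<nu>. AE x in K \<theta>. P (\<theta>, x))"
    proof (rule AE_cong)
      fix \<theta> assume "\<theta> \<in> space \<nu>"
      then have \<theta>: "\<theta> \<in> space B" by (simp add: \<nu>sp)
      have [measurable_cong]: "sets (K \<theta>) = sets S" by (rule K'(2)[OF \<theta>])
      show "(AE z in K \<theta> \<bind> (\<lambda>x. return (B \<Otimes>\<^sub>M S) (\<theta>, x)). P z) \<longleftrightarrow> (AE x in K \<theta>. P (\<theta>, x))"
        unfolding pair_kernel_eq_distr[OF K \<theta>] using \<theta> by (subst AE_distr_iff) auto
    qed
    finally show ?thesis .
  qed
  show "distr J B fst = \<nu>"
  proof (rule measure_eqI)
    fix A assume "A \<in> sets (distr J B fst)"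
    then have A[measurable]: "A \<in> sets B" by simp
    have [measurable_cong]: "sets J = sets (B \<Otimes>\<^sub>M S)" by fact
    have "emeasure (distr J B fst) A = emeasure J (fst -` A \<inter> space (B \<Otimes>\<^sub>M S))"
      using sets_eq_imp_space_eq[OF sJ] by (simp add: emeasure_distr)
    also have "\<dots> = (\<integral>\<^sup>+\<theta>. emeasure (K \<theta>) (Pair \<theta> -` (fst -` A \<inter> space (B \<Otimes>\<^sub>M S))) \<partial>\<nu>)"
      by (rule em) measurable
    also have "\<dots> = (\<integral>\<^sup>+\<theta>. indicator A \<theta> \<partial>\<nu>)"
    proof (rule nn_integral_cong)
      fix \<theta> assume "\<theta> \<in> space \<nu>"
      then have \<theta>: "\<theta> \<in> space B" by (simp add: \<nu>sp)
      then have "Pair \<theta> -` (fst -` A \<inter> space (B \<Otimes>\<^sub>M S)) = (if \<theta> \<in> A then space (K \<theta>) else {})"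
        by (auto simp: space_pair_measure K'(3))
      then show "emeasure (K \<theta>) (Pair \<theta> -` (fst -` A \<inter> space (B \<Otimes>\<^sub>M S))) = indicator A \<theta>"
        using prob_space.emeasure_space_1[OF K'(1)[OF \<theta>]] by (simp split: split_indicator)
    qed
    also have "\<dots> = emeasure \<nu> A" by simp
    finally show "emeasure (distr J B fst) A = emeasure \<nu> A" .
  qed (simp add: \<nu>s)
qed

text \<open>
  The exceptions are enclosed in a measurable null set, whose sections are null for almost every
  parameter by \<open>AE_joint\<close>.
\<close>

lemma AE_joint_D:
  assumes \<nu>: "\<nu> \<in> space (prob_algebra B)" and K: "K \<in> B \<rightarrow>\<^sub>M prob_algebra S"
    and AE: "AE z in \<nu> \<bind> (\<lambda>\<theta>. K \<theta> \<bind> (\<lambda>x. return (B \<Otimes>\<^sub>M S) (\<theta>, x))). P z"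
  shows "AE \<theta> in \<nu>. AE x in K \<theta>. P (\<theta>, x)"
proof -
  let ?J = "\<nu> \<bind> (\<lambda>\<theta>. K \<theta> \<bind> (\<lambda>x. return (B \<Otimes>\<^sub>M S) (\<theta>, x)))"
  note sJ = sets_joint[OF \<nu> K]
  from AE obtain Z where Z: "{z \<in> space ?J. \<not> P z} \<subseteq> Z" "emeasure ?J Z = 0" "Z \<in> sets ?J"
    by (rule AE_E)
  have [measurable]: "Z \<in> sets (B \<Otimes>\<^sub>M S)" using Z(3) unfolding sJ .
  have "AE z in ?J. z \<notin> Z" using Z(2,3) by (intro AE_not_in null_setsI)
  then have "AE \<theta> in \<nu>. AE x in K \<theta>. (\<theta>, x) \<notin> Z"
    by (subst (asm) AE_joint[OF \<nu> K]) measurable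
  then show ?thesis using AE_space
  proof eventually_elim
    case (elim \<theta>)
    have \<theta>: "\<theta> \<in> space B" using elim(2) \<nu> by (auto simp: space_prob_algebra dest: sets_eq_imp_space_eq)
    then have Ksp: "space (K \<theta>) = space S"
      using measurable_space[OF K] by (auto simp: space_prob_algebra dest: sets_eq_imp_space_eq)
    have sp: "space ?J = space B \<times> space S" using sets_eq_imp_space_eq[OF sJ] by (simp add: space_pair_measure)
    show ?case using elim(1) AE_space
    proof eventually_elim
      case (elim x)
      have "(\<theta>, x) \<in> space ?J" using elim(2) \<theta> unfolding sp Ksp by simp
      then show ?case using elim(1) Z(1) by blast
    qed
  qed
qed

section \<open>A countable determining class\<close>

text \<open>
  Finite intersections of members of a countable basis, cut down to \<open>X\<close>, form a countable generator
  that is closed under intersection.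
\<close>

lemma countable_determining_class:
  fixes X :: "'x::second_countable_topology set"
  assumes X: "X \<in> sets borel"
  obtains A :: "nat \<Rightarrow> 'x set" where "\<And>j. A j \<in> sets (restrict_space borel X)"
    "\<And>\<mu> \<mu>'. prob_space \<mu> \<Longrightarrow> prob_space \<mu>' \<Longrightarrow> sets \<mu> = sets (restrict_space borel X) \<Longrightarrow>
      sets \<mu>' = sets (restrict_space borel X) \<Longrightarrow> (\<And>j. measure \<mu> (A j) = measure \<mu>' (A j)) \<Longrightarrow> \<mu> = \<mu>'"
proof -
  obtain \<B> :: "'x set set" where \<B>: "countable \<B>" "topological_basis \<B>"
    using ex_countable_basis by blast
  \<comment> \<open>the empty intersection puts \<open>UNIV\<close>, hence later \<open>X\<close> itself, among the generators\<close>
  define \<I> where "\<I> = Inter ` {T. finite T \<and> T \<subseteq> \<B>}"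
  have \<I>: "countable \<I>" unfolding \<I>_def
    using countable_Collect_finite_subset[OF \<B>(1)] by (intro countable_image)
  have \<I>o: "\<I> \<subseteq> {S. open S}"
    using topological_basis_open[OF \<B>(2)] by (auto simp: \<I>_def intro!: open_Inter)
  have "(borel :: 'x measure) = sigma UNIV \<B>" using \<B> by (rule borel_eq_countable_basis)
  then have "sets (borel :: 'x measure) = sigma_sets UNIV \<B>"
    by (metis Pow_UNIV sets_measure_of top_greatest)
  moreover have "sigma_sets UNIV \<B> \<subseteq> sigma_sets UNIV \<I>"
  proof (rule sigma_sets_mono')
    show "\<B> \<subseteq> \<I>"
    proof
      fix b assume "b \<in> \<B>" then show "b \<in> \<I>" unfolding \<I>_def by (intro image_eqI[of _ _ "{b}"]) auto
    qed
  qed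
  moreover have "sigma_sets UNIV \<I> \<subseteq> sets (borel :: 'x measure)"
  proof -
    have "\<I> \<subseteq> sets (borel :: 'x measure)" using \<I>o by (auto intro: borel_open)
    from sets.sigma_sets_subset[OF this] show ?thesis by simp
  qed
  ultimately have borel: "sets (borel :: 'x measure) = sigma_sets UNIV \<I>" by auto
  let ?E = "(\<inter>) X ` \<I>"
  have gen: "sets (restrict_space borel X) = sigma_sets X ?E"
  proof -
    have "(\<inter>) X ` sigma_sets UNIV \<I> = sigma_sets X ?E"
      using X by (intro sigma_sets_Int) (auto simp: borel)
    then show ?thesis by (simp add: sets_restrict_space borel)
  qed
  have XE: "X \<in> ?E"
    by (rule image_eqI[of _ _ UNIV]) (auto simp: \<I>_def intro!: image_eqI[of _ _ "{}"])
  have stable: "Int_stable ?E"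
  proof (rule Int_stableI_image)
    fix S S' assume "S \<in> \<I>" "S' \<in> \<I>"
    then obtain T T' where "finite T" "T \<subseteq> \<B>" "S = \<Inter>T" "finite T'" "T' \<subseteq> \<B>" "S' = \<Inter>T'"
      by (auto simp: \<I>_def)
    then have "S \<inter> S' \<in> \<I>" unfolding \<I>_def by (intro image_eqI[of _ _ "T \<union> T'"]) auto
    then show "\<exists>c\<in>\<I>. X \<inter> S \<inter> (X \<inter> S') = X \<inter> c" by (intro bexI[of _ "S \<inter> S'"]) auto
  qed
  have cE: "countable ?E" using \<I> by simp
  have rng: "range (from_nat_into ?E) = ?E" using XE cE by (intro range_from_nat_into) auto
  show thesis
  proof (rule that[of "from_nat_into ?E"])
    fix j
    have "from_nat_into ?E j \<in> ?E" using XE by (intro from_nat_into) auto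
    then show "from_nat_into ?E j \<in> sets (restrict_space borel X)"
      unfolding gen by (rule sigma_sets.Basic)
  next
    fix \<mu> \<mu>' :: "'x measure"
    assume prob: "prob_space \<mu>" "prob_space \<mu>'"
      and sets: "sets \<mu> = sets (restrict_space borel X)" "sets \<mu>' = sets (restrict_space borel X)"
      and eq: "\<And>j. measure \<mu> (from_nat_into ?E j) = measure \<mu>' (from_nat_into ?E j)"
    interpret \<mu>: prob_space \<mu> by fact
    interpret \<mu>': prob_space \<mu>' by fact
    show "\<mu> = \<mu>'"
    proof (rule measure_eqI_generator_eq[OF stable, of X _ _ "\<lambda>_. X"])
      fix S assume "S \<in> ?E"
      then obtain j where "S = from_nat_into ?E j" using rng by (metis imageE)
      then show "emeasure \<mu> S = emeasure \<mu>' S"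
        using eq[of j] by (simp add: \<mu>.emeasure_eq_measure \<mu>'.emeasure_eq_measure)
    qed (use XE sets gen in auto)
  qed
qed

section \<open>The mixture model\<close>

locale mixture_model =
  fixes X :: "'x::second_countable_topology set"
    and V :: "'v::{banach, second_countable_topology} set"
    and F :: "'v \<Rightarrow> 'x measure"
    and \<pi> :: "nat measure"
    and D :: "nat \<Rightarrow> (nat \<Rightarrow> real) measure"
    and G :: "nat \<Rightarrow> (nat \<Rightarrow> 'v) measure"
  assumes X: "X \<in> sets borel"
    and V[measurable]: "V \<in> sets borel"
    and F: "\<And>v. v \<in> V \<Longrightarrow> prob_space (F v) \<and> sets (F v) = sets (restrict_space borel X)"
    and \<pi>: "prob_space \<pi>" "sets \<pi> = sets (count_space {1..})"
    and D: "\<And>k. k \<ge> 1 \<Longrightarrow> prob_space (D k) \<and> sets (D k) = sets (Delta_borel k)"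
    and G: "\<And>k. k \<ge> 1 \<Longrightarrow> prob_space (G k) \<and> sets (G k) = sets (power_borel k V)"
    and meas: "\<And>A. A \<in> sets (restrict_space borel X) \<Longrightarrow>
          (\<lambda>v. measure (F v) A) \<in> borel_measurable (restrict_space borel V)"
    and ident: "\<And>k k' w w' v v'.
          k \<ge> 1 \<Longrightarrow> k' \<ge> 1 \<Longrightarrow> w \<in> Delta k \<Longrightarrow> w' \<in> Delta k' \<Longrightarrow>
          v \<in> PiE {..<k} (\<lambda>_. V) \<Longrightarrow> v' \<in> PiE {..<k'} (\<lambda>_. V) \<Longrightarrow>
          P_param X F (k, w, v) = P_param X F (k', w', v') \<Longrightarrow>
          mixture (restrict_space borel V) k w (\<lambda>i. return (restrict_space borel V) (v i)) =
          mixture (restrict_space borel V) k' w' (\<lambda>i. return (restrict_space borel V) (v' i))"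
    and distinct: "\<And>k i j. k \<ge> 1 \<Longrightarrow> i < j \<Longrightarrow> j < k \<Longrightarrow> \<P>(v in G k. v i = v j) = 0"
begin

abbreviation "N \<equiv> restrict_space borel X"
abbreviation "B \<equiv> Theta_borel V"
abbreviation "S \<equiv> PiM (UNIV :: nat set) (\<lambda>_. N)"
abbreviation "\<nu> \<equiv> prior V \<pi> D G"
abbreviation "M \<equiv> model X V F \<pi> D G"
abbreviation "K \<theta> \<equiv> PiM (UNIV :: nat set) (\<lambda>_. P_param X F \<theta>)"

text \<open>
  The probability of \<open>A\<close> under \<open>P_param X F \<theta>\<close> for \<open>\<theta>\<close> in \<open>Theta V\<close>. The indicator, which is 1 at
  every component of such a \<open>\<theta>\<close>, makes it a Borel function on the whole parameter type.
\<close>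

definition mixprob :: "'x set \<Rightarrow> 'v param \<Rightarrow> real" where
  "mixprob A \<theta> = (\<Sum>i<fst \<theta>. fst (snd \<theta>) i *
     (indicator V (snd (snd \<theta>) i) * measure (F (snd (snd \<theta>) i)) A))"

lemma measurable_mixprob [measurable]:
  assumes A: "A \<in> sets N"
  shows "mixprob A \<in> borel_measurable borel"
proof -
  have [measurable]: "(\<lambda>v. indicator V v * measure (F v) A) \<in> borel_measurable borel"
    using meas[OF A] by (subst (asm) borel_measurable_restrict_space_iff) (auto simp: V)
  show ?thesis unfolding mixprob_def[abs_def]
    by (rule measurable_compose_countable[where g=fst and f="\<lambda>k \<theta>. \<Sum>i<k. fst (snd \<theta>) i *
      (indicator V (snd (snd \<theta>) i) * measure (F (snd (snd \<theta>) i)) A)"]) measurable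
qed

lemma borel_measurable_B:
  "f \<in> borel \<rightarrow>\<^sub>M L \<Longrightarrow> f \<in> B \<rightarrow>\<^sub>M L"
  unfolding measurable_cong_sets[OF sets_Theta_borel[OF V] refl] by (rule measurable_restrict_space1)

lemma P_param_Theta:
  assumes "\<theta> \<in> Theta V"
  shows prob_space_P_param: "prob_space (P_param X F \<theta>)" and sets_P_param: "sets (P_param X F \<theta>) = sets N"
    and measure_P_param: "A \<in> sets N \<Longrightarrow> measure (P_param X F \<theta>) A = mixprob A \<theta>"
proof -
  obtain k w v where \<theta>: "\<theta> = (k, w, v)" by (cases \<theta>)
  have w: "w \<in> Delta k" and v: "\<And>i. i < k \<Longrightarrow> v i \<in> V"
    using assms by (auto simp: Theta_iff \<theta>)
  show "prob_space (P_param X F \<theta>)" using F v unfolding \<theta> P_param.simps by (intro prob_space_mixture[OF w]) auto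
  show "sets (P_param X F \<theta>) = sets N" by (simp add: \<theta>)
  assume A: "A \<in> sets N"
  have "emeasure (P_param X F \<theta>) A = (\<Sum>i<k. ennreal (w i) * emeasure (F (v i)) A)"
    unfolding \<theta> P_param.simps using F v A by (intro emeasure_mixture) auto
  also have "\<dots> = (\<Sum>i<k. ennreal (w i * (indicator V (v i) * measure (F (v i)) A)))"
  proof (intro sum.cong refl)
    fix i assume "i \<in> {..<k}"
    then have i: "i < k" by simp
    interpret prob_space "F (v i)" using F v[OF i] by blast
    show "ennreal (w i) * emeasure (F (v i)) A = ennreal (w i * (indicator V (v i) * measure (F (v i)) A))"
      using v[OF i] DeltaD(2)[OF w i] by (simp add: emeasure_eq_measure ennreal_mult)
  qed
  also have "\<dots> = ennreal (mixprob A \<theta>)"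
    using DeltaD(2)[OF w] by (simp add: mixprob_def \<theta>, subst sum_ennreal) auto
  finally have em: "emeasure (P_param X F \<theta>) A = ennreal (mixprob A \<theta>)" .
  have "0 \<le> mixprob A \<theta>"
    using DeltaD(2)[OF w] by (auto simp: mixprob_def \<theta> intro!: sum_nonneg mult_nonneg_nonneg)
  with em show "measure (P_param X F \<theta>) A = mixprob A \<theta>" by (simp add: measure_def)
qed

lemma measurable_P_param: "P_param X F \<in> B \<rightarrow>\<^sub>M prob_algebra N"
proof (intro measurable_prob_algebraI measurable_subprob_algebra)
  fix A assume A: "A \<in> sets N"
  have "(\<lambda>\<theta>. ennreal (mixprob A \<theta>)) \<in> borel_measurable B"
    using A by (intro borel_measurable_B) measurable
  also have "?this \<longleftrightarrow> (\<lambda>\<theta>. emeasure (P_param X F \<theta>) A) \<in> borel_measurable B"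
  proof (rule measurable_cong)
    fix \<theta> assume "\<theta> \<in> space B"
    then have \<theta>: "\<theta> \<in> Theta V" by (simp add: V)
    interpret prob_space "P_param X F \<theta>" by (rule prob_space_P_param[OF \<theta>])
    show "ennreal (mixprob A \<theta>) = emeasure (P_param X F \<theta>) A"
      using measure_P_param[OF \<theta> A] by (simp add: emeasure_eq_measure)
  qed
  finally show "(\<lambda>\<theta>. emeasure (P_param X F \<theta>) A) \<in> borel_measurable B" .
qed (simp_all add: V P_param_Theta prob_space_imp_subprob_space)

lemma measurable_K: "K \<in> B \<rightarrow>\<^sub>M prob_algebra S"
  by (rule measurable_PiM_kernel[OF measurable_P_param])

lemma measurable_into_B:
  assumes "f \<in> L \<rightarrow>\<^sub>M borel" "\<And>x. x \<in> space L \<Longrightarrow> f x \<in> Theta V"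
  shows "f \<in> L \<rightarrow>\<^sub>M B"
  unfolding measurable_cong_sets[OF refl sets_Theta_borel[OF V]]
  using assms by (intro measurable_restrict_space2) auto

lemma measurable_params:
  assumes k: "k \<ge> 1"
  shows "(\<lambda>(w, v). (k, w, v)) \<in> D k \<Otimes>\<^sub>M G k \<rightarrow>\<^sub>M B"
proof (rule measurable_into_B)
  have Ds: "sets (D k) = sets (restrict_space (PiM {..<k} (\<lambda>_. borel)) (Delta k))"
    and Gs: "sets (G k) = sets (PiM {..<k} (\<lambda>_. restrict_space borel V))"
    using D[OF k] G[OF k] by (simp_all add: Delta_borel_def power_borel_def)
  have Dsp: "space (D k) = Delta k" using sets_eq_imp_space_eq[OF Ds]
    by (auto simp: space_restrict_space space_PiM Delta_def PiE_iff extensional_def)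
  have Gsp: "space (G k) = PiE {..<k} (\<lambda>_. V)" using sets_eq_imp_space_eq[OF Gs]
    by (auto simp: space_PiM)
  have D1: "(\<lambda>w. w i) \<in> borel_measurable (D k)" for i
  proof (cases "i < k")
    case True
    then show ?thesis unfolding measurable_cong_sets[OF Ds refl]
      by (intro measurable_restrict_space1 measurable_component_singleton) auto
  next
    case False
    then have "(\<lambda>w. w i) \<in> borel_measurable (D k) \<longleftrightarrow> (\<lambda>w. undefined :: real) \<in> borel_measurable (D k)"
      by (intro measurable_cong) (auto simp: Dsp DeltaD)
    then show ?thesis by simp
  qed
  have G1: "(\<lambda>v. v i) \<in> borel_measurable (G k)" for i
  proof (cases "i < k")
    case True
    then have "(\<lambda>v. v i) \<in> G k \<rightarrow>\<^sub>M restrict_space borel V" unfolding measurable_cong_sets[OF Gs refl]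
      by (intro measurable_component_singleton) auto
    then show ?thesis by (rule measurable_restrict_space2_iff[THEN iffD1, THEN conjunct1])
  next
    case False
    then have "(\<lambda>v. v i) \<in> borel_measurable (G k) \<longleftrightarrow> (\<lambda>v. undefined :: 'v) \<in> borel_measurable (G k)"
      by (intro measurable_cong) (auto simp: Gsp PiE_iff extensional_def)
    then show ?thesis by simp
  qed
  have [measurable]: "(\<lambda>w. w) \<in> borel_measurable (D k)" "(\<lambda>v. v) \<in> borel_measurable (G k)"
    using D1 G1 by (auto intro!: measurable_coordinatewise_then_product)
  show "(\<lambda>(w, v). (k, w, v)) \<in> D k \<Otimes>\<^sub>M G k \<rightarrow>\<^sub>M borel"
    unfolding borel_prod[symmetric] by measurable
  show "(case x of (w, v) \<Rightarrow> (k, w, v)) \<in> Theta V" if "x \<in> space (D k \<Otimes>\<^sub>M G k)" for x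
  proof -
    obtain w v where x: "x = (w, v)" by (cases x)
    with that have "w \<in> space (D k)" "v \<in> space (G k)" by (simp_all add: space_pair_measure)
    then show ?thesis unfolding x Dsp Gsp using k by (simp add: Theta_iff)
  qed
qed

lemma prob_algebra_self: "k \<ge> 1 \<Longrightarrow> D k \<in> space (prob_algebra (D k))" "k \<ge> 1 \<Longrightarrow> G k \<in> space (prob_algebra (G k))"
  using D G by (auto simp: space_prob_algebra)

lemma measurable_G_return:
  assumes k: "k \<ge> 1"
  shows "(\<lambda>w. G k \<bind> (\<lambda>v. return B (k, w, v))) \<in> D k \<rightarrow>\<^sub>M prob_algebra B"
proof (rule measurable_bind_prob_space2)
  show "(\<lambda>w. G k) \<in> D k \<rightarrow>\<^sub>M prob_algebra (G k)"
    by (rule measurable_const) (rule prob_algebra_self[OF k])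
  show "(\<lambda>(w, v). return B (k, w, v)) \<in> D k \<Otimes>\<^sub>M G k \<rightarrow>\<^sub>M prob_algebra B"
    using measurable_compose[OF measurable_params[OF k] measurable_return_prob_space]
    by (simp add: case_prod_unfold)
qed

lemma measurable_D_bind:
  "(\<lambda>k. D k \<bind> (\<lambda>w. G k \<bind> (\<lambda>v. return B (k, w, v)))) \<in> \<pi> \<rightarrow>\<^sub>M prob_algebra B"
proof -
  have "D k \<bind> (\<lambda>w. G k \<bind> (\<lambda>v. return B (k, w, v))) \<in> space (prob_algebra B)" if "k \<ge> 1" for k
    using prob_space_bind'[OF prob_algebra_self(1) measurable_G_return] that
      sets_bind'[OF prob_algebra_self(1) measurable_G_return] by (simp add: space_prob_algebra)
  then show ?thesis unfolding measurable_cong_sets[OF \<pi>(2) refl] by simp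
qed

lemma \<pi>_self: "\<pi> \<in> space (prob_algebra \<pi>)" using \<pi> by (simp add: space_prob_algebra)

lemma prior_space: "\<nu> \<in> space (prob_algebra B)"
  using prob_space_bind'[OF \<pi>_self measurable_D_bind] sets_bind'[OF \<pi>_self measurable_D_bind]
  by (simp add: prior_def space_prob_algebra)

lemma sets_prior: "sets \<nu> = sets B" and prob_space_prior: "prob_space \<nu>"
  using prior_space by (auto simp: space_prob_algebra)

lemma space_prior: "space \<nu> = Theta V"
  using sets_eq_imp_space_eq[OF sets_prior] by (simp add: V)

lemma AE_prior_inj: "AE \<theta> in \<nu>. inj_on (snd (snd \<theta>)) {..<fst \<theta>}"
proof -
  let ?P = "\<lambda>\<theta> :: 'v param. inj_on (snd (snd \<theta>)) {..<fst \<theta>}"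
  have P[measurable]: "Measurable.pred B ?P"
    by (rule borel_measurable_B) (simp add: inj_on_def Ball_def)
  have "AE \<theta> in D k \<bind> (\<lambda>w. G k \<bind> (\<lambda>v. return B (k, w, v))). ?P \<theta>" if k: "k \<ge> 1" for k
  proof -
    interpret G: prob_space "G k" using G[OF k] by blast
    have Gs[measurable_cong]: "sets (G k) = sets (PiM {..<k} (\<lambda>_. restrict_space borel V))"
      using G[OF k] by (simp add: power_borel_def)
    have "AE v in G k. v i \<noteq> v j" if "i < j" "j < k" for i j
    proof -
      have c: "(\<lambda>v. v i) \<in> G k \<rightarrow>\<^sub>M restrict_space borel V" if "i < k" for i
        unfolding measurable_cong_sets[OF Gs refl] using that
        by (intro measurable_component_singleton) auto
      have [measurable]: "(\<lambda>v. v i) \<in> borel_measurable (G k)" "(\<lambda>v. v j) \<in> borel_measurable (G k)"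
        using that c[of i] c[of j] by (auto simp: measurable_restrict_space2_iff)
      have "{v \<in> space (G k). v i = v j} \<in> sets (G k)" by measurable
      from G.prob_Collect_eq_0[OF this] distinct[OF k that] show ?thesis by simp
    qed
    then have "AE v in G k. i < j \<longrightarrow> j < k \<longrightarrow> v i \<noteq> v j" for i j
      by (cases "i < j \<and> j < k") auto
    then have "AE v in G k. \<forall>i j. i < j \<longrightarrow> j < k \<longrightarrow> v i \<noteq> v j" unfolding AE_all_countable by blast
    then have *: "AE v in G k. inj_on v {..<k}"
    proof eventually_elim
      case (elim v)
      show ?case
      proof (rule inj_onI)
        fix i j assume "i \<in> {..<k}" "j \<in> {..<k}" "v i = v j"
        then show "i = j" using elim by (cases i j rule: linorder_cases) (auto, metis)
      qed
    qed
    have "AE \<theta> in G k \<bind> (\<lambda>v. return B (k, w, v)). ?P \<theta>" if w: "w \<in> space (D k)" for w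
    proof -
      have m: "(\<lambda>v. (k, w, v)) \<in> G k \<rightarrow>\<^sub>M B"
        using measurable_compose[OF measurable_Pair1'[OF w] measurable_params[OF k]] by simp
      have "AE \<theta> in distr (G k) B (\<lambda>v. (k, w, v)). ?P \<theta>"
        using * P by (subst AE_distr_iff[OF m]) (auto simp: pred_def)
      then show ?thesis unfolding bind_return_distr'[OF G.not_empty m, simplified] .
    qed
    then show ?thesis
      by (subst AE_bind[OF measurable_prob_algebraD[OF measurable_G_return[OF k]] P]) simp
  qed
  moreover have "space \<pi> = {1..}" using sets_eq_imp_space_eq[OF \<pi>(2)] by simp
  ultimately show ?thesis unfolding prior_def
    by (subst AE_bind[OF measurable_prob_algebraD[OF measurable_D_bind] P]) (rule AE_I2, simp)
qed

section \<open>Events that the data determine\<close>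

lemma M_eq: "M = \<nu> \<bind> (\<lambda>\<theta>. K \<theta> \<bind> (\<lambda>x. return (B \<Otimes>\<^sub>M S) (\<theta>, x)))"
  by (simp add: model_def)

lemmas prob_space_M = prob_space_joint[OF prior_space measurable_K, folded M_eq]
lemmas sets_M = sets_joint[OF prior_space measurable_K, folded M_eq]
lemmas emeasure_M = emeasure_joint[OF prior_space measurable_K, folded M_eq]
lemmas distr_M_fst = distr_joint_fst[OF prior_space measurable_K, folded M_eq]
lemmas AE_M_D = AE_joint_D[OF prior_space measurable_K, folded M_eq]

lemma space_M: "space M = Theta V \<times> space S"
  using sets_eq_imp_space_eq[OF sets_M] by (simp add: space_pair_measure V)

lemma measurable_fst_M: "f \<in> borel \<rightarrow>\<^sub>M L \<Longrightarrow> (\<lambda>\<omega>. f (fst \<omega>)) \<in> M \<rightarrow>\<^sub>M L"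
  unfolding measurable_cong_sets[OF sets_M refl]
  by (rule measurable_compose[OF measurable_fst borel_measurable_B])

lemma measurable_snd_M: "snd \<in> M \<rightarrow>\<^sub>M S"
  unfolding measurable_cong_sets[OF sets_M refl] by simp

text \<open>
  The information in the first \<open>n + 1\<close> observations; the shift by one is there because the posterior is
  specified for at least one observation.
\<close>

definition filt :: "nat \<Rightarrow> ('v param \<times> (nat \<Rightarrow> 'x)) measure" where
  "filt n = vimage_algebra (space M) (\<lambda>\<omega>. restrict (snd \<omega>) {..<Suc n}) (PiM {..<Suc n} (\<lambda>_. N))"

lemma space_filt: "space (filt n) = space M" by (simp add: filt_def)

lemma restrict_in_space_PiM: "x \<in> space S \<Longrightarrow> restrict x {..<n} \<in> space (PiM {..<n} (\<lambda>_. N))"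
  by (auto simp: space_PiM)

lemma measurable_data: "(\<lambda>\<omega>. restrict (snd \<omega>) {..<n}) \<in> M \<rightarrow>\<^sub>M PiM {..<n} (\<lambda>_. N)"
  by (rule measurable_compose[OF measurable_snd_M]) (rule measurable_restrict_subset, simp)

lemma sets_filt: "sets (filt n) =
    {(\<lambda>\<omega>. restrict (snd \<omega>) {..<Suc n}) -` A \<inter> space M | A. A \<in> sets (PiM {..<Suc n} (\<lambda>_. N))}"
  unfolding filt_def by (rule sets_vimage_algebra2) (auto simp: space_M intro: restrict_in_space_PiM)

lemma subalgebra_filt: "subalgebra M (filt n)"
  unfolding subalgebra_def space_filt sets_filt using measurable_sets[OF measurable_data] by auto

lemma filt_mono:
  assumes "m \<le> n"
  shows "sets (filt m) \<subseteq> sets (filt n)"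
proof
  fix A assume "A \<in> sets (filt m)"
  then obtain C where C: "A = (\<lambda>\<omega>. restrict (snd \<omega>) {..<Suc m}) -` C \<inter> space M"
      "C \<in> sets (PiM {..<Suc m} (\<lambda>_. N))"
    unfolding sets_filt by blast
  have "(\<lambda>y. restrict y {..<Suc m}) \<in> PiM {..<Suc n} (\<lambda>_. N) \<rightarrow>\<^sub>M PiM {..<Suc m} (\<lambda>_. N)"
    using assms by (intro measurable_restrict_subset) auto
  from measurable_sets[OF this C(2)]
  have C': "(\<lambda>y. restrict y {..<Suc m}) -` C \<inter> space (PiM {..<Suc n} (\<lambda>_. N)) \<in> sets (PiM {..<Suc n} (\<lambda>_. N))" .
  have "restrict (restrict y {..<Suc n}) {..<Suc m} = restrict y {..<Suc m}" for y :: "nat \<Rightarrow> 'x"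
    using assms by (auto simp: restrict_def fun_eq_iff)
  then have "A = (\<lambda>\<omega>. restrict (snd \<omega>) {..<Suc n}) -`
      ((\<lambda>y. restrict y {..<Suc m}) -` C \<inter> space (PiM {..<Suc n} (\<lambda>_. N))) \<inter> space M"
    using restrict_in_space_PiM unfolding C(1) by (auto simp: space_M)
  with C' show "A \<in> sets (filt n)" unfolding sets_filt by blast
qed

abbreviation "observable \<equiv> approximable M (\<Union>n. sets (filt n))"

lemma cylinder_algebra: "algebra (space M) (\<Union>n. sets (filt n))" "(\<Union>n. sets (filt n)) \<subseteq> sets M"
  using algebra_UN_subalgebras[of filt, OF space_filt filt_mono] subalgebra_filt
  by (auto simp: subalgebra_def)

lemma sigma_algebra_observable: "sigma_algebra (space M) observable"
proof -
  interpret prob_space M by (rule prob_space_M)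
  show ?thesis by (rule sigma_algebra_approximable[OF cylinder_algebra])
qed

text \<open>
  The weak law makes \<open>mixprob A \<theta>\<close> the limit in probability, under the joint law, of the frequencies of
  \<open>A\<close> among the observations.
\<close>

lemma observable_mixprob:
  assumes A: "A \<in> sets N"
  shows "{\<omega> \<in> space M. c < mixprob A (fst \<omega>)} \<in> observable"
proof -
  interpret prob_space M by (rule prob_space_M)
  define fr where "fr n x = (\<Sum>i<Suc n. indicator A (x i)) / real (Suc n)" for n and x :: "nat \<Rightarrow> 'x"
  show ?thesis
  proof (rule approximable_limit_in_measure[where fn = "\<lambda>n \<omega>. fr n (snd \<omega>)"])
    show "(\<lambda>\<omega>. mixprob A (fst \<omega>)) \<in> borel_measurable M"
      using A by (intro measurable_fst_M) measurable
    show "{\<omega> \<in> space M. c < fr n (snd \<omega>)} \<in> (\<Union>n. sets (filt n))" for n c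
    proof -
      have [measurable]: "fr n \<in> borel_measurable (PiM {..<Suc n} (\<lambda>_. N))"
        unfolding fr_def[abs_def] using A by measurable
      have "fr n (restrict x {..<Suc n}) = fr n x" for x
        unfolding fr_def by (intro arg_cong2[where f="(/)"] sum.cong refl) simp
      then have "{\<omega> \<in> space M. c < fr n (snd \<omega>)} = (\<lambda>\<omega>. restrict (snd \<omega>) {..<Suc n}) -`
          {x \<in> space (PiM {..<Suc n} (\<lambda>_. N)). c < fr n x} \<inter> space M"
        using restrict_in_space_PiM by (auto simp: space_M)
      also have "\<dots> \<in> sets (filt n)" unfolding sets_filt
        by (rule CollectI, rule exI[of _ "{x \<in> space (PiM {..<Suc n} (\<lambda>_. N)). c < fr n x}"],
            rule conjI[OF refl]) measurable
      finally show ?thesis by blast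
    qed
    show "(\<Union>n. sets (filt n)) \<subseteq> sets M" by (rule cylinder_algebra)
    fix \<eta> \<delta> :: real assume \<eta>: "\<eta> > 0" and \<delta>: "\<delta> > 0"
    obtain n where n: "2 * exp (- 2 * real (Suc n) * \<eta>\<^sup>2) < \<delta>"
    proof -
      obtain n where n: "2 / \<delta> < real n * (2 * \<eta>\<^sup>2)"
        using reals_Archimedean3[of "2 * \<eta>\<^sup>2"] \<eta> by auto
      define y where "y = 2 * real (Suc n) * \<eta>\<^sup>2"
      note n
      also have "real n * (2 * \<eta>\<^sup>2) \<le> y" by (simp add: y_def algebra_simps)
      also have "y \<le> exp y" using exp_ge_add_one_self[of y] by linarith
      finally have "2 * exp (- y) < \<delta>"
        using \<delta> by (simp add: exp_minus field_simps)
      moreover have "- y = - 2 * real (Suc n) * \<eta>\<^sup>2" by (simp add: y_def algebra_simps)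
      ultimately have "2 * exp (- 2 * real (Suc n) * \<eta>\<^sup>2) < \<delta>" by metis
      then show ?thesis by (rule that)
    qed
    let ?E = "{\<omega> \<in> space M. \<eta> \<le> \<bar>fr n (snd \<omega>) - mixprob A (fst \<omega>)\<bar>}"
    have m1: "(\<lambda>\<omega>. mixprob A (fst \<omega>)) \<in> borel_measurable M"
      using A by (intro measurable_fst_M) measurable
    have "fr n \<in> borel_measurable S" unfolding fr_def[abs_def] using A by measurable
    then have m2: "(\<lambda>\<omega>. fr n (snd \<omega>)) \<in> borel_measurable M"
      by (rule measurable_compose[OF measurable_snd_M])
    have E: "?E \<in> sets (B \<Otimes>\<^sub>M S)"
      unfolding sets_M[symmetric] using m1 m2 by measurable
    have "emeasure M ?E = (\<integral>\<^sup>+\<theta>. emeasure (K \<theta>) (Pair \<theta> -` ?E) \<partial>\<nu>)"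
      by (rule emeasure_M[OF E])
    also have "\<dots> \<le> (\<integral>\<^sup>+\<theta>. ennreal (2 * exp (- 2 * real (Suc n) * \<eta>\<^sup>2)) \<partial>\<nu>)"
    proof (rule nn_integral_mono)
      fix \<theta> assume "\<theta> \<in> space \<nu>"
      then have \<theta>: "\<theta> \<in> Theta V" by (simp add: space_prior)
      note p = prob_space_P_param[OF \<theta>]
      interpret K: prob_space "K \<theta>" by (rule prob_space_PiM[OF p])
      have Ksp: "space (K \<theta>) = space S"
        using sets_eq_imp_space_eq[OF sets_P_param[OF \<theta>]] by (simp add: space_PiM)
      have "Pair \<theta> -` ?E = {x \<in> space (K \<theta>). \<eta> \<le> \<bar>(\<Sum>i<Suc n. indicator A (x i)) / real (Suc n)
          - measure (P_param X F \<theta>) A\<bar>}"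
        using \<theta> unfolding measure_P_param[OF \<theta> A] Ksp by (auto simp: space_M fr_def)
      then have "measure (K \<theta>) (Pair \<theta> -` ?E) \<le> 2 * exp (- 2 * real (Suc n) * \<eta>\<^sup>2)"
        using weak_law_frequencies[OF p, of A "Suc n" \<eta>] A \<eta> by (simp add: sets_P_param[OF \<theta>])
      then show "emeasure (K \<theta>) (Pair \<theta> -` ?E) \<le> ennreal (2 * exp (- 2 * real (Suc n) * \<eta>\<^sup>2))"
        by (simp add: K.emeasure_eq_measure ennreal_leI)
    qed
    also have "\<dots> = ennreal (2 * exp (- 2 * real (Suc n) * \<eta>\<^sup>2))"
      using prob_space.emeasure_space_1[OF prob_space_prior] by simp
    finally have "measure M ?E \<le> 2 * exp (- 2 * real (Suc n) * \<eta>\<^sup>2)"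
      by (simp add: emeasure_eq_measure)
    with n show "\<exists>n. measure M {\<omega> \<in> space M. \<eta> \<le> \<bar>fr n (snd \<omega>) - mixprob A (fst \<omega>)\<bar>} < \<delta>"
      by (intro exI[of _ n]) linarith
  qed
qed

lemma observable_mixprob_vimage:
  assumes A: "\<And>j :: nat. A j \<in> sets N" and C: "C \<in> sets borel"
  shows "{\<omega> \<in> space M. (\<lambda>j. mixprob (A j) (fst \<omega>)) \<in> C} \<in> observable"
proof -
  let ?O = "sigma (space M) observable"
  have sO: "sets ?O = observable" and spO: "space ?O = space M"
    using sigma_algebra.sets_measure_of_eq[OF sigma_algebra_observable]
    by (simp_all add: space_measure_of_conv)
  have "(\<lambda>\<omega>. mixprob (A j) (fst \<omega>)) \<in> borel_measurable ?O" for j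
    unfolding borel_measurable_iff_greater spO sO using observable_mixprob[OF A] by blast
  then have "(\<lambda>\<omega>. (\<lambda>j. mixprob (A j) (fst \<omega>))) \<in> borel_measurable ?O"
    by (rule measurable_coordinatewise_then_product)
  from measurable_sets[OF this C] show ?thesis
    unfolding sO spO by (simp add: vimage_def Int_def conj_commute)
qed

lemma P_param_eq_imp_permuted:
  assumes \<theta>: "\<theta> \<in> Theta V" "\<theta>' \<in> Theta V" and eq: "P_param X F \<theta> = P_param X F \<theta>'"
    and inj: "inj_on (snd (snd \<theta>)) {..<fst \<theta>}" "inj_on (snd (snd \<theta>')) {..<fst \<theta>'}"
  obtains \<sigma> where "\<sigma> permutes {..<fst \<theta>'}" "\<theta> = permute_param \<theta>' \<sigma>"
proof -
  obtain k w v k' w' v' where t: "\<theta> = (k, w, v)" "\<theta>' = (k', w', v')" by (cases \<theta>; cases \<theta>')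
  have *: "k \<ge> 1" "k' \<ge> 1" "w \<in> Delta k" "w' \<in> Delta k'" "v \<in> PiE {..<k} (\<lambda>_. V)" "v' \<in> PiE {..<k'} (\<lambda>_. V)"
    using \<theta> by (simp_all add: Theta_iff t)
  show thesis
    using mixture_return_identifiable[OF *(3-6) _ _ ident[OF * eq[unfolded t]]] inj that
    by (simp add: t) blast
qed

text \<open>
  If \<open>C\<close> is a compact subset of the image of the part of \<open>U\<close> with distinct components, then a parameter
  with distinct components and with \<open>\<tau> \<theta> \<in> C\<close> generates the same distribution as a member of \<open>U\<close>. It is
  then a permutation of that member, and so lies in \<open>U\<close>. Thus \<open>{\<tau> \<theta> \<in> C}\<close>, which is observable, lies in
  \<open>{\<theta> \<in> U}\<close> up to a null set, and the choice of \<open>C\<close> makes the difference small.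
\<close>

lemma observable_symmetric:
  assumes U: "U \<in> sets borel" "U \<subseteq> Theta V"
    and sym: "\<And>\<theta> \<sigma>. \<theta> \<in> U \<Longrightarrow> \<sigma> permutes {..<fst \<theta>} \<Longrightarrow> permute_param \<theta> \<sigma> \<in> U"
  shows "{\<omega> \<in> space M. fst \<omega> \<in> U} \<in> observable"
proof (rule approximableI)
  interpret prob_space M by (rule prob_space_M)
  have m: "{\<omega> \<in> space M. fst \<omega> \<in> W} \<in> sets M" if "W \<in> sets borel" for W
    using measurable_sets[OF measurable_fst_M[of "\<lambda>x. x" borel], of W] that
    by (simp add: vimage_def Int_def conj_commute)
  show "{\<omega> \<in> space M. fst \<omega> \<in> U} \<in> sets M" by (rule m[OF U(1)])
  obtain A :: "nat \<Rightarrow> 'x set" where A: "\<And>j. A j \<in> sets N"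
    "\<And>\<mu> \<mu>'. prob_space \<mu> \<Longrightarrow> prob_space \<mu>' \<Longrightarrow> sets \<mu> = sets N \<Longrightarrow>
      sets \<mu>' = sets N \<Longrightarrow> (\<And>j. measure \<mu> (A j) = measure \<mu>' (A j)) \<Longrightarrow> \<mu> = \<mu>'"
    using countable_determining_class[OF X] by blast
  define \<tau> where "\<tau> \<theta> = (\<lambda>j. mixprob (A j) \<theta>)" for \<theta>
  have \<tau>: "\<tau> \<in> borel_measurable borel" unfolding \<tau>_def[abs_def]
    using A(1) by (intro measurable_coordinatewise_then_product measurable_mixprob)
  define I where "I = {\<theta> :: 'v param. inj_on (snd (snd \<theta>)) {..<fst \<theta>}}"
  have I: "I \<in> sets borel"
  proof -
    have "{\<theta> \<in> space borel. inj_on (snd (snd \<theta>)) {..<fst \<theta>}} \<in> sets (borel :: 'v param measure)"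
      unfolding inj_on_def Ball_def by measurable
    then show ?thesis by (simp add: I_def)
  qed
  define \<nu>' where "\<nu>' = distr M borel fst"
  have fM: "fst \<in> M \<rightarrow>\<^sub>M borel" using measurable_fst_M[of "\<lambda>x. x" borel] by simp
  have \<nu>'_eq: "measure \<nu>' W = measure M {\<omega> \<in> space M. fst \<omega> \<in> W}" if "W \<in> sets borel" for W
    unfolding \<nu>'_def using that by (subst measure_distr[OF fM]) (auto intro!: arg_cong[where f="measure M"])
  have null: "measure M {\<omega> \<in> space M. fst \<omega> \<notin> I} = 0"
  proof -
    have "AE \<theta> in distr M B fst. \<theta> \<in> I" unfolding distr_M_fst using AE_prior_inj by (simp add: I_def)
    then have "AE \<omega> in M. fst \<omega> \<in> I"
      by (rule AE_distrD[rotated]) (simp add: measurable_cong_sets[OF sets_M refl])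
    then show ?thesis
      using m[OF I[THEN borel_comp]] by (subst prob_Collect_eq_0) auto
  qed
  fix \<delta> :: real assume \<delta>: "\<delta> > 0"
  have UI: "U \<inter> I \<in> sets borel" using U(1) I by simp
  obtain C where C: "compact C" "C \<subseteq> \<tau> ` (U \<inter> I)" "measure \<nu>' (U \<inter> I - \<tau> -` C) < \<delta>/2"
  proof (rule inner_compact_image[OF _ _ measurable_encode measurable_decode decode_encode \<tau> UI])
    show "finite_measure \<nu>'" unfolding \<nu>'_def by (rule finite_measure_distr[OF fM])
    show "sets \<nu>' = sets borel" by (simp add: \<nu>'_def)
    show "\<delta>/2 > 0" using \<delta> by simp
  qed blast
  have Cb: "C \<in> sets borel" using C(1) by (rule borel_compact)
  let ?E = "{\<omega> \<in> space M. \<tau> (fst \<omega>) \<in> C}"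
  have E: "?E \<in> observable" unfolding \<tau>_def by (rule observable_mixprob_vimage[OF A(1) Cb])
  then have Es: "?E \<in> sets M" by (simp add: approximable_def)
  obtain B' where B': "B' \<in> (\<Union>n. sets (filt n))" "measure M (sym_diff ?E B') < \<delta>/2"
    using approximableE[OF E, of "\<delta>/2"] \<delta> by auto
  have B_sets: "B' \<in> sets M" using B'(1) cylinder_algebra(2) by auto
  have in_U: "\<theta> \<in> U" if \<theta>: "\<theta> \<in> Theta V" "\<theta> \<in> I" "\<tau> \<theta> \<in> C" for \<theta>
  proof -
    obtain \<theta>' where \<theta>': "\<theta>' \<in> U" "\<theta>' \<in> I" "\<tau> \<theta> = \<tau> \<theta>'" using C(2) \<theta>(3) by blast
    have V': "\<theta>' \<in> Theta V" using \<theta>'(1) U(2) by blast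
    have "P_param X F \<theta> = P_param X F \<theta>'"
      using \<theta>'(3) P_param_Theta[OF \<theta>(1)] P_param_Theta[OF V'] A(1)
      by (intro A(2)) (auto simp: \<tau>_def fun_eq_iff)
    then obtain \<sigma> where "\<sigma> permutes {..<fst \<theta>'}" "\<theta> = permute_param \<theta>' \<sigma>"
      using P_param_eq_imp_permuted[OF \<theta>(1) V'] \<theta>(2) \<theta>'(2) by (auto simp: I_def)
    then show ?thesis using sym[OF \<theta>'(1)] by simp
  qed
  let ?R = "{\<omega> \<in> space M. fst \<omega> \<in> U \<inter> I - \<tau> -` C}"
  have Wb: "U \<inter> I - \<tau> -` C \<in> sets borel"
    using UI measurable_sets[OF \<tau> Cb] by auto
  have sub: "sym_diff {\<omega> \<in> space M. fst \<omega> \<in> U} ?E \<subseteq> {\<omega> \<in> space M. fst \<omega> \<notin> I} \<union> ?R"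
    using in_U by (auto simp: space_M)
  have "measure M (sym_diff {\<omega> \<in> space M. fst \<omega> \<in> U} ?E) \<le> measure M {\<omega> \<in> space M. fst \<omega> \<notin> I} + measure M ?R"
    using m[OF I[THEN borel_comp]] by (intro measure_le_of_subset_Un[OF sub] m[OF Wb]) simp
  also have "\<dots> < \<delta>/2" using C(3) null \<nu>'_eq[OF Wb] by simp
  finally have 1: "measure M (sym_diff {\<omega> \<in> space M. fst \<omega> \<in> U} ?E) < \<delta>/2" .
  have "measure M (sym_diff {\<omega> \<in> space M. fst \<omega> \<in> U} B')
      \<le> measure M (sym_diff {\<omega> \<in> space M. fst \<omega> \<in> U} ?E) + measure M (sym_diff ?E B')"
    using m[OF U(1)] Es B_sets by (intro measure_le_of_subset_Un) auto
  then show "\<exists>B'\<in>(\<Union>n. sets (filt n)). measure M (sym_diff {\<omega> \<in> space M. fst \<omega> \<in> U} B') < \<delta>"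
    using 1 B' by (intro bexI[of _ B']) auto
qed

section \<open>Posterior consistency\<close>

text \<open>
  The posterior probability of the complement of \<open>U\<close> is a version of the conditional probability of
  \<open>{\<theta> \<notin> U}\<close> given the data, so it tends to 0 outside this event.
\<close>

lemma posterior_tendsto_1:
  assumes Q: "\<And>n. n \<ge> 1 \<Longrightarrow> regular_cond_distr M fst B
      (\<lambda>\<omega>. restrict (snd \<omega>) {..<n}) (PiM {..<n} (\<lambda>_. N)) (Q n)"
    and U: "U \<in> sets B" "{\<omega> \<in> space M. fst \<omega> \<in> U} \<in> observable"
  shows "AE \<omega> in M. fst \<omega> \<in> U \<longrightarrow> (\<lambda>n. measure (Q n (restrict (snd \<omega>) {..<n})) U) \<longlonglongrightarrow> 1"
proof -
  interpret prob_space M by (rule prob_space_M)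
  let ?U = "Theta V - U"
  have U': "?U \<in> sets B" using sets.compl_sets[OF U(1)] by (simp add: V)
  define Z where "Z n \<omega> = restrict (snd \<omega>) {..<Suc n}" for n and \<omega> :: "'v param \<times> (nat \<Rightarrow> 'x)"
  let ?L = "\<lambda>n. PiM {..<Suc n} (\<lambda>_. N)"
  define q where "q n \<omega> = measure (Q (Suc n) (Z n \<omega>)) ?U" for n \<omega>
  have Qm: "Q (Suc n) \<in> ?L n \<rightarrow>\<^sub>M prob_algebra B" for n
    using Q[of "Suc n"] by (simp add: regular_cond_distr_def)
  have Q_cond: "emeasure M {\<omega> \<in> space M. fst \<omega> \<in> A \<and> Z n \<omega> \<in> C}
      = (\<integral>\<^sup>+z\<in>C. emeasure (Q (Suc n) z) A \<partial>distr M (?L n) (Z n))"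
    if "A \<in> sets B" "C \<in> sets (?L n)" for n A C
    using Q[of "Suc n"] that unfolding regular_cond_distr_def Z_def[abs_def] by simp
  have ZM: "Z n \<in> M \<rightarrow>\<^sub>M ?L n" for n unfolding Z_def[abs_def] by (rule measurable_data)
  have Zfilt: "Z n \<in> filt n \<rightarrow>\<^sub>M ?L n" for n
    unfolding filt_def Z_def[abs_def] by (rule measurable_vimage_algebra1) (auto simp: space_M intro: restrict_in_space_PiM)
  have QU: "(\<lambda>z. measure (Q (Suc n) z) ?U) \<in> borel_measurable (?L n)" for n
    by (rule measurable_compose[OF Qm measurable_measure_prob_algebra[OF U']])
  have Qsp: "prob_space (Q (Suc n) (Z n \<omega>))" "sets (Q (Suc n) (Z n \<omega>)) = sets B"
    if "\<omega> \<in> space M" for n \<omega>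
    using measurable_space[OF Qm measurable_space[OF ZM that]] by (auto simp: space_prob_algebra)
  have "AE \<omega> in M. \<omega> \<notin> {\<omega> \<in> space M. fst \<omega> \<notin> U} \<longrightarrow> (\<lambda>n. q n \<omega>) \<longlonglongrightarrow> 0"
  proof (rule cond_prob_tendsto_0_off[OF subalgebra_filt filt_mono])
    show "q n \<in> borel_measurable (filt n)" for n
      unfolding q_def[abs_def] by (rule measurable_compose[OF Zfilt QU])
    show "0 \<le> q n \<omega>" for n \<omega> by (simp add: q_def)
    show "(\<integral>\<^sup>+\<omega>\<in>A. ennreal (q n \<omega>) \<partial>M) = emeasure M ({\<omega> \<in> space M. fst \<omega> \<notin> U} \<inter> A)"
      if A: "A \<in> sets (filt n)" for n A
    proof -
      obtain C where C: "A = Z n -` C \<inter> space M" "C \<in> sets (?L n)"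
        using A unfolding sets_filt by (elim CollectE exE conjE) (rule that, simp_all add: Z_def[abs_def])
      have "{\<omega> \<in> space M. fst \<omega> \<notin> U} \<inter> A = {\<omega> \<in> space M. fst \<omega> \<in> ?U \<and> Z n \<omega> \<in> C}"
        by (auto simp: C(1) space_M)
      then have "emeasure M ({\<omega> \<in> space M. fst \<omega> \<notin> U} \<inter> A)
          = (\<integral>\<^sup>+z\<in>C. emeasure (Q (Suc n) z) ?U \<partial>distr M (?L n) (Z n))"
        using Q_cond[OF U' C(2)] by (simp only:)
      also have "\<dots> = (\<integral>\<^sup>+\<omega>. emeasure (Q (Suc n) (Z n \<omega>)) ?U * indicator C (Z n \<omega>) \<partial>M)"
        using C(2) measurable_compose[OF measurable_prob_algebraD[OF Qm] measurable_emeasure_subprob_algebra[OF U']]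
        by (intro nn_integral_distr[OF ZM] borel_measurable_times_ennreal borel_measurable_indicator) auto
      also have "\<dots> = (\<integral>\<^sup>+\<omega>\<in>A. ennreal (q n \<omega>) \<partial>M)"
      proof (rule nn_integral_cong)
        fix \<omega> assume \<omega>: "\<omega> \<in> space M"
        interpret Q: prob_space "Q (Suc n) (Z n \<omega>)" by (rule Qsp[OF \<omega>])
        show "emeasure (Q (Suc n) (Z n \<omega>)) ?U * indicator C (Z n \<omega>) = ennreal (q n \<omega>) * indicator A \<omega>"
          using \<omega> by (simp add: q_def Q.emeasure_eq_measure C(1) indicator_def)
      qed
      finally show ?thesis by simp
    qed
    interpret O: sigma_algebra "space M" observable by (rule sigma_algebra_observable)
    have "space M - {\<omega> \<in> space M. fst \<omega> \<in> U} \<in> observable"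
      by (rule O.compl_sets[OF U(2)])
    then show "{\<omega> \<in> space M. fst \<omega> \<notin> U} \<in> observable"
      by (rule back_subst[where P="\<lambda>A. A \<in> observable"]) auto
  qed
  then show ?thesis using AE_space
  proof eventually_elim
    case (elim \<omega>)
    show ?case
    proof
      assume "fst \<omega> \<in> U"
      then have "(\<lambda>n. 1 - q n \<omega>) \<longlonglongrightarrow> 1 - 0" using elim(1) by (intro tendsto_intros) auto
      moreover have "1 - q n \<omega> = measure (Q (Suc n) (restrict (snd \<omega>) {..<Suc n})) U" for n
      proof -
        interpret Q: prob_space "Q (Suc n) (Z n \<omega>)" by (rule Qsp[OF elim(2)])
        have "space (Q (Suc n) (Z n \<omega>)) = Theta V"
          using sets_eq_imp_space_eq[OF Qsp(2)[OF elim(2)]] by (simp add: V)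
        then have "q n \<omega> = 1 - measure (Q (Suc n) (Z n \<omega>)) U"
          unfolding q_def using Q.prob_compl[of U] U(1) Qsp(2)[OF elim(2)] by simp
        then show ?thesis by (simp add: Z_def)
      qed
      ultimately have "(\<lambda>n. measure (Q (Suc n) (restrict (snd \<omega>) {..<Suc n})) U) \<longlonglongrightarrow> 1" by simp
      then show "(\<lambda>n. measure (Q n (restrict (snd \<omega>) {..<n})) U) \<longlonglongrightarrow> 1"
        by (rule LIMSEQ_imp_Suc)
    qed
  qed
qed

text \<open>
  One null set of parameters serves all \<open>\<epsilon>\<close> at once because only the countably many sets
  \<open>orbit_meets V W\<close>, with \<open>W\<close> in a countable basis, enter its choice.
\<close>

theorem posterior_consistency:
  assumes Q: "\<And>n. n \<ge> 1 \<Longrightarrow> regular_cond_distr M fst B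
      (\<lambda>\<omega>. restrict (snd \<omega>) {..<n}) (PiM {..<n} (\<lambda>_. N)) (Q n)"
  shows "\<exists>\<Theta>s \<subseteq> Theta V.
      \<P>(\<omega> in M. fst \<omega> \<in> \<Theta>s) = 1 \<and>
      (\<forall>\<theta>\<^sub>0 \<in> \<Theta>s.
         (\<forall>\<epsilon>>0. AE x in K \<theta>\<^sub>0.
            (\<lambda>n. measure (Q n (restrict x {..<n})) (Btilde V \<theta>\<^sub>0 \<epsilon>)) \<longlonglongrightarrow> 1) \<and>
         (AE x in K \<theta>\<^sub>0.
            (\<lambda>n. measure (Q n (restrict x {..<n})) {\<theta> \<in> Theta V. ncomp \<theta> = ncomp \<theta>\<^sub>0})
              \<longlonglongrightarrow> 1))"
proof -
  interpret prob_space M by (rule prob_space_M)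
  interpret \<nu>: prob_space \<nu> by (rule prob_space_prior)
  obtain \<O> :: "'v param set set" where \<O>: "countable \<O>" "topological_basis \<O>"
    using ex_countable_basis by blast
  have \<O>_open: "W \<in> \<O> \<Longrightarrow> open W" for W using topological_basis_open[OF \<O>(2)] .
  let ?good = "\<lambda>\<theta> x. \<forall>W\<in>\<O>. \<theta> \<in> orbit_meets V W \<longrightarrow>
      (\<lambda>n. measure (Q n (restrict x {..<n})) (orbit_meets V W)) \<longlonglongrightarrow> 1"
  have U_sets: "orbit_meets V W \<in> sets B" if "W \<in> \<O>" for W
  proof -
    have "orbit_meets V W = Theta V \<inter> orbit_meets V W" by (auto simp: orbit_meets_def)
    then show ?thesis unfolding sets_Theta_borel[OF V] sets_restrict_space
      using orbit_meets_borel[OF V \<O>_open[OF that]] by blast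
  qed
  have "AE \<omega> in M. \<forall>W\<in>\<O>. fst \<omega> \<in> orbit_meets V W \<longrightarrow>
      (\<lambda>n. measure (Q n (restrict (snd \<omega>) {..<n})) (orbit_meets V W)) \<longlonglongrightarrow> 1"
  proof (subst AE_ball_countable[OF \<O>(1)], intro ballI)
    fix W assume W: "W \<in> \<O>"
    have "{\<omega> \<in> space M. fst \<omega> \<in> orbit_meets V W} \<in> observable"
      by (rule observable_symmetric[OF orbit_meets_borel[OF V \<O>_open[OF W]] _ orbit_meets_permute])
        (auto simp: orbit_meets_def)
    from posterior_tendsto_1[OF Q U_sets[OF W] this]
    show "AE \<omega> in M. fst \<omega> \<in> orbit_meets V W \<longrightarrow>
      (\<lambda>n. measure (Q n (restrict (snd \<omega>) {..<n})) (orbit_meets V W)) \<longlonglongrightarrow> 1" .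
  qed
  from AE_M_D[OF this] have "AE \<theta> in \<nu>. AE x in K \<theta>. ?good \<theta> x" by simp
  then obtain Z where Z: "{\<theta> \<in> space \<nu>. \<not> (AE x in K \<theta>. ?good \<theta> x)} \<subseteq> Z" "emeasure \<nu> Z = 0" "Z \<in> sets \<nu>"
    by (rule AE_E)
  define \<Theta>s where "\<Theta>s = Theta V - Z"
  have \<Theta>s: "\<Theta>s \<in> sets B" using Z(3) sets.Diff[OF sets.top[of \<nu>] Z(3)]
    by (simp add: \<Theta>s_def sets_prior space_prior)
  have "\<P>(\<omega> in M. fst \<omega> \<in> \<Theta>s) = measure (distr M B fst) \<Theta>s"
    using \<Theta>s by (subst measure_distr)
      (auto simp: measurable_cong_sets[OF sets_M refl] intro!: arg_cong[where f="measure M"])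
  also have "\<dots> = 1"
    unfolding distr_M_fst \<Theta>s_def space_prior[symmetric] using Z(2,3)
    by (subst \<nu>.prob_compl) (auto simp: measure_def)
  finally have 1: "\<P>(\<omega> in M. fst \<omega> \<in> \<Theta>s) = 1" .
  have nbhd: "AE x in K \<theta>\<^sub>0. (\<lambda>n. measure (Q n (restrict x {..<n})) A) \<longlonglongrightarrow> 1"
    if \<theta>\<^sub>0: "\<theta>\<^sub>0 \<in> \<Theta>s" and A: "A \<in> sets B" and \<epsilon>: "\<epsilon> > 0" "\<epsilon> \<le> 1"
      and sub: "Btilde V \<theta>\<^sub>0 \<epsilon> \<inter> {\<theta> \<in> Theta V. ncomp \<theta> = ncomp \<theta>\<^sub>0} \<subseteq> A" for \<theta>\<^sub>0 A \<epsilon>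
  proof -
    have T: "\<theta>\<^sub>0 \<in> Theta V" using \<theta>\<^sub>0 by (simp add: \<Theta>s_def)
    have AE: "AE x in K \<theta>\<^sub>0. ?good \<theta>\<^sub>0 x" using \<theta>\<^sub>0 Z(1) T by (auto simp: \<Theta>s_def space_prior)
    interpret Metric_space "Theta V" d_Theta by (rule Metric_space_Theta)
    have "d_Theta \<theta>\<^sub>0 \<theta>\<^sub>0 < \<epsilon>" using T \<epsilon> by simp
    then obtain W where W: "W \<in> \<O>" "\<theta>\<^sub>0 \<in> W" "W \<subseteq> {\<theta>. d_Theta \<theta>\<^sub>0 \<theta> < \<epsilon>}"
      using topological_basisE[OF \<O>(2) open_d_Theta_ball] by blast
    have "\<theta>\<^sub>0 \<in> orbit_meets V W" using T W(2) permutes_id[of "{..<fst \<theta>\<^sub>0}"]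
      by (auto simp: orbit_meets_def permute_param_id intro!: exI[of _ id])
    moreover have UA: "orbit_meets V W \<subseteq> A"
      using orbit_meets_subset_Btilde[OF T W(3) \<epsilon>(2)] sub by blast
    show ?thesis using AE AE_space
    proof eventually_elim
      case (elim x)
      have x: "x \<in> space S" using elim(2) sets_eq_imp_space_eq[OF sets_P_param[OF T]] by (simp add: space_PiM)
      have lim: "(\<lambda>n. measure (Q n (restrict x {..<n})) (orbit_meets V W)) \<longlonglongrightarrow> 1"
        using elim(1) W(1) \<open>\<theta>\<^sub>0 \<in> orbit_meets V W\<close> by blast
      have bounds: "measure (Q n (restrict x {..<n})) (orbit_meets V W) \<le> measure (Q n (restrict x {..<n})) A
          \<and> measure (Q n (restrict x {..<n})) A \<le> 1" if n: "n \<ge> 1" for n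
      proof -
        have "Q n \<in> PiM {..<n} (\<lambda>_. N) \<rightarrow>\<^sub>M prob_algebra B" using Q[OF n] by (simp add: regular_cond_distr_def)
        from measurable_space[OF this restrict_in_space_PiM[OF x]]
        have "prob_space (Q n (restrict x {..<n}))" and s: "sets (Q n (restrict x {..<n})) = sets B"
          by (auto simp: space_prob_algebra)
        then interpret Q: prob_space "Q n (restrict x {..<n})" by simp
        show ?thesis using UA A by (auto intro!: Q.finite_measure_mono simp: s)
      qed
      show ?case
      proof (rule tendsto_sandwich[OF _ _ lim tendsto_const])
        show "\<forall>\<^sub>F n in sequentially. measure (Q n (restrict x {..<n})) (orbit_meets V W) \<le> measure (Q n (restrict x {..<n})) A"
          using bounds by (intro eventually_sequentiallyI[of 1]) blast
        show "\<forall>\<^sub>F n in sequentially. measure (Q n (restrict x {..<n})) A \<le> 1"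
          using bounds by (intro eventually_sequentiallyI[of 1]) blast
      qed
    qed
  qed
  show ?thesis
  proof (intro exI[of _ \<Theta>s] conjI ballI allI impI)
    show "\<Theta>s \<subseteq> Theta V" by (auto simp: \<Theta>s_def)
    fix \<theta>\<^sub>0 assume \<theta>\<^sub>0: "\<theta>\<^sub>0 \<in> \<Theta>s"
    show "AE x in K \<theta>\<^sub>0. (\<lambda>n. measure (Q n (restrict x {..<n})) {\<theta> \<in> Theta V. ncomp \<theta> = ncomp \<theta>\<^sub>0}) \<longlonglongrightarrow> 1"
      by (rule nbhd[OF \<theta>\<^sub>0 ncomp_measurable[OF V], of 1]) auto
    fix \<epsilon> :: real assume \<epsilon>: "\<epsilon> > 0"
    \<comment> \<open>radii above 1 would also admit parameters with another number of components\<close>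
    have "Btilde V \<theta>\<^sub>0 (min \<epsilon> 1) \<subseteq> Btilde V \<theta>\<^sub>0 \<epsilon>" by (auto simp: Btilde_def)
    then show "AE x in K \<theta>\<^sub>0. (\<lambda>n. measure (Q n (restrict x {..<n})) (Btilde V \<theta>\<^sub>0 \<epsilon>)) \<longlonglongrightarrow> 1"
      using \<epsilon> by (intro nbhd[OF \<theta>\<^sub>0 Btilde_measurable[OF V], of "min \<epsilon> 1"]) auto
  qed (rule 1)
qed

end

theorem theorem3p1:
  fixes X :: "'x::polish_space set"
    and V :: "(real ^ 'd) set"
    and F :: "real ^ 'd \<Rightarrow> 'x measure"
    and \<pi> :: "nat measure"
    and D :: "nat \<Rightarrow> (nat \<Rightarrow> real) measure"
    and G :: "nat \<Rightarrow> (nat \<Rightarrow> real ^ 'd) measure"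
    and Q :: "nat \<Rightarrow> (nat \<Rightarrow> 'x) \<Rightarrow> (real ^ 'd) param measure"
  assumes X: "X \<in> sets borel"
    and V: "V \<in> sets borel"
    and F: "\<And>v. v \<in> V \<Longrightarrow> prob_space (F v) \<and> sets (F v) = sets (restrict_space borel X)"
    and \<pi>: "prob_space \<pi>" "sets \<pi> = sets (count_space {1..})"
    and D: "\<And>k. k \<ge> 1 \<Longrightarrow> prob_space (D k) \<and> sets (D k) = sets (Delta_borel k)"
    and G: "\<And>k. k \<ge> 1 \<Longrightarrow> prob_space (G k) \<and> sets (G k) = sets (power_borel k V)"
    and Q: "\<And>n. n \<ge> 1 \<Longrightarrow>
          regular_cond_distr (model X V F \<pi> D G)
            fst (Theta_borel V)
            (\<lambda>\<omega>. restrict (snd \<omega>) {..<n}) (PiM {..<n} (\<lambda>_. restrict_space borel X))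
            (Q n)"
    and meas: "\<And>A. A \<in> sets (restrict_space borel X) \<Longrightarrow>
          (\<lambda>v. measure (F v) A) \<in> borel_measurable (restrict_space borel V)"
    and ident: "\<And>k k' w w' v v'.
          k \<ge> 1 \<Longrightarrow> k' \<ge> 1 \<Longrightarrow> w \<in> Delta k \<Longrightarrow> w' \<in> Delta k' \<Longrightarrow>
          v \<in> PiE {..<k} (\<lambda>_. V) \<Longrightarrow> v' \<in> PiE {..<k'} (\<lambda>_. V) \<Longrightarrow>
          P_param X F (k, w, v) = P_param X F (k', w', v') \<Longrightarrow>
          mixture (restrict_space borel V) k w (\<lambda>i. return (restrict_space borel V) (v i)) =
          mixture (restrict_space borel V) k' w' (\<lambda>i. return (restrict_space borel V) (v' i))"
    and distinct: "\<And>k i j. k \<ge> 1 \<Longrightarrow> i < j \<Longrightarrow> j < k \<Longrightarrow> \<P>(v in G k. v i = v j) = 0"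
  shows "\<exists>\<Theta>s \<subseteq> Theta V.
      \<P>(\<omega> in model X V F \<pi> D G. fst \<omega> \<in> \<Theta>s) = 1 \<and>
      (\<forall>\<theta>\<^sub>0 \<in> \<Theta>s.
         (\<forall>\<epsilon>>0. AE x in PiM UNIV (\<lambda>_. P_param X F \<theta>\<^sub>0).
            (\<lambda>n. measure (Q n (restrict x {..<n})) (Btilde V \<theta>\<^sub>0 \<epsilon>)) \<longlonglongrightarrow> 1) \<and>
         (AE x in PiM UNIV (\<lambda>_. P_param X F \<theta>\<^sub>0).
            (\<lambda>n. measure (Q n (restrict x {..<n})) {\<theta> \<in> Theta V. ncomp \<theta> = ncomp \<theta>\<^sub>0})
              \<longlonglongrightarrow> 1))"
proof -
  interpret m: mixture_model X V F \<pi> D G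
  proof (rule mixture_model.intro)
  qed (fact X V F \<pi> D G meas ident distinct)+
  show ?thesis by (rule m.posterior_consistency[OF Q])
qed

end
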